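(* Let $F:\mathbb{N}^{\mathbb{N}}\to\mathbb{N}$ be a (total) functional. There is an isomorphism of pcas $\mathcal{K}_1[F]\cong\mathcal{K}_1^F$.
   Context: Pcas. A partial applicative structure on a set $A$ is a partial map $A\times A\to A$, written $(a,b)\mapsto ab$; application associates to the left. $t\downarrow$ means $t$ is defined; $t\lesssim s$ means: if $s\downarrow$ then $t\downarrow$ and $t=s$; $t\simeq s$ means $t\lesssim s$ and $s\lesssim t$. A pca is a partial applicative structure for which there are $\mathsf{k},\mathsf{s}\in A$ with, for all $a,b,c\in A$: $\mathsf{s}ab\downarrow$, $\mathsf{k}ab=a$, $\mathsf{s}abc\lesssim ac(bc)$. An applicative morphism $\gamma:A\to B$ of pcas is a relation with $\gamma(a)=\{b\in B: a\,\gamma\, b\}\neq\emptyset$ for all $a\in A$, for which there is $r\in B$ such that whenever $aa'\downarrow$ in $A$, then for all $b\in\gamma(a),b'\in\gamma(a')$ one has $rbb'\downarrow$ and $rbb'\in\gamma(aa')$. Composition is composition of relations, and the identity morphism is the identity relation. An isomorphism of pcas is an isomorphism in the resulting category. $\mathcal{K}_1$ (Kleene's first model) is the pca on $\mathbb{N}$ with $nm\simeq\phi_n(m)$, $\phi_n$ being the $n$-th partial recursive function. The pca $A[F]$. Let $A$ be a pca. Fix in $A$ booleans $\mathsf{T},\mathsf{F}$ ($\mathsf{T}ab=a$, $\mathsf{F}ab=b$), a pairing combinator $\mathsf{p}$ with projections ($\mathsf{p}_0(\mathsf{p}ab)=a$, $\mathsf{p}_1(\mathsf{p}ab)=b$),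 and a standard coding of finite tuples $[u_0,\ldots,u_n]\in A$ (and an empty tuple $[\,]$) for which projections, concatenation $*$ and length are computable in $A$; write $u^{<i}=[u_0,\ldots,u_{i-1}]$. For a partial function $f:A\to A$ and $a,b\in A$, an $f$-dialogue between $a$ and $b$ is a (possibly empty) tuple $u=[u_0,\ldots,u_n]$ such that for each $i\le n$ there is $v_i$ with $a([b]*u^{<i})=\mathsf{p}\,\mathsf{F}\,v_i$, $f(v_i)$ defined and $f(v_i)=u_i$. Put $a\cdot^f b=c$ if there is an $f$-dialogue $u$ between $a$ and $b$ with $a([b]*u)=\mathsf{p}\,\mathsf{T}\,c$. $A[f]$ denotes the set $A$ with the application $\cdot^f$ (it is a pca). For a (partial) functional $F:A^A\to A$ define partial functions $f_\alpha:A\to A$ by transfinite recursion: $f_0=\emptyset$; $f_{\alpha+1}(a)=b$ iff there is a total $g:A\to A$ with $a\cdot^{f_\alpha}x=g(x)$ for all $x\in A$ and with $F(g)$ defined and equal to $b$; $f_\lambda=\bigcup_{\alpha<\lambda}f_\alpha$ for limit $\lambda$. These are compatible; put $f=\bigcup_\alpha f_\alpha$ and $A[F]:=A[f]$. $\mathcal{K}_1[F]$ is the case $A=\mathcal{K}_1$. The pca $\mathcal{K}_1^F$. Fix a primitive recursive coding of tuples $\langle -\rangle:\mathbb{N}^{<\omega}\to\mathbb{N}$. An indexed family of partial functions $\{e\}:\mathbb{N}^{<\omega}\to\mathbb{N}$, $e\in\mathbb{N}$, is defined inductively by the following rules (all variables range over $\mathbb{N}$): S1: $\{\langle 1,1\rangle\}(n)=n+1$.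 S2: $\{\langle 2,1,m\rangle\}(n)=m$. S3: $\{\langle 3,m\rangle\}(n_1,\ldots,n_m)=n_1$. S4: $\{\langle 4,k,g,h\rangle\}(n_1,\ldots,n_k)\simeq\{g\}(\{h\}(n_1,\ldots,n_k),n_1,\ldots,n_k)$. S5: if $m=\langle 5,2,g,h\rangle$ then $\{m\}(0,n)\simeq\{g\}(n)$ and $\{m\}(k+1,n)\simeq\{h\}(k,\{m\}(k,n),n)$. S6: for $1\le k<r$, $\{\langle 6,r,k,g\rangle\}(n_1,\ldots,n_r)\simeq\{g\}(n_{k+1},n_1,\ldots,n_k,n_{k+2},\ldots,n_r)$. S8: $\{\langle 8,1,h\rangle\}(n)\simeq F(\lambda k.\{h\}(k,n))$ (defined iff $\{h\}(k,n)$ is defined for all $k$). S9: $\{\langle 9,k,l\rangle\}(m,n_1,\ldots,n_{k+l})\simeq\{m\}(n_1,\ldots,n_k)$. $\mathcal{K}_1^F$ is the set $\mathbb{N}$ with the application $(e,n)\mapsto\{e\}(n)$ (it is a pca). *)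

theory Defs
  imports Main "HOL-Library.Nat_Bijection"
begin

section \<open>Partial combinatory algebras\<close>

text \<open>A partial applicative structure on the (nonempty) set of all elements of type \<open>'a\<close>;
  the value \<open>None\<close> means ``undefined''.\<close>

type_synonym 'a pas = "'a \<Rightarrow> 'a \<Rightarrow> 'a option"

definition papp :: "'a option \<Rightarrow> 'a pas \<Rightarrow> 'a option \<Rightarrow> 'a option"
    ("(_ \<cdot>\<^bsub>_\<^esub>/ _)" [90, 0, 91] 90)
  where "t \<cdot>\<^bsub>A\<^esub> s = Option.bind t (\<lambda>a. Option.bind s (A a))"

definition plesssim :: "'a option \<Rightarrow> 'a option \<Rightarrow> bool"  (infix "\<lesssim>" 50)
  where "t \<lesssim> s \<longleftrightarrow> (s \<noteq> None \<longrightarrow> t = s)"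

definition pca :: "'a pas \<Rightarrow> bool"
  where "pca A \<longleftrightarrow> (\<exists>k s. \<forall>a b c.
     Some s \<cdot>\<^bsub>A\<^esub> Some a \<cdot>\<^bsub>A\<^esub> Some b \<noteq> None \<and>
     Some k \<cdot>\<^bsub>A\<^esub> Some a \<cdot>\<^bsub>A\<^esub> Some b = Some a \<and>
     Some s \<cdot>\<^bsub>A\<^esub> Some a \<cdot>\<^bsub>A\<^esub> Some b \<cdot>\<^bsub>A\<^esub> Some c
       \<lesssim> (Some a \<cdot>\<^bsub>A\<^esub> Some c) \<cdot>\<^bsub>A\<^esub> (Some b \<cdot>\<^bsub>A\<^esub> Some c))"

definition applicative_morphism :: "'a pas \<Rightarrow> 'b pas \<Rightarrow> ('a \<times> 'b) set \<Rightarrow> bool"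
  where "applicative_morphism A B \<gamma> \<longleftrightarrow>
     (\<forall>a. \<gamma> `` {a} \<noteq> {}) \<and>
     (\<exists>r. \<forall>a a' c. A a a' = Some c \<longrightarrow>
        (\<forall>b \<in> \<gamma> `` {a}. \<forall>b' \<in> \<gamma> `` {a'}.
           \<exists>d \<in> \<gamma> `` {c}. Some r \<cdot>\<^bsub>B\<^esub> Some b \<cdot>\<^bsub>B\<^esub> Some b' = Some d))"

definition pca_isomorphic :: "'a pas \<Rightarrow> 'b pas \<Rightarrow> bool"
  where "pca_isomorphic A B \<longleftrightarrow> pca A \<and> pca B \<and>
     (\<exists>\<gamma> \<delta>. applicative_morphism A B \<gamma> \<and> applicative_morphism B A \<delta> \<and>
            \<gamma> O \<delta> = Id \<and> \<delta> O \<gamma> = Id)"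

definition graph_val :: "('a \<Rightarrow> bool) \<Rightarrow> 'a option"
  where "graph_val P = (if \<exists>!y. P y then Some (THE y. P y) else None)"

lemma graph_val_eq_Some_iff:
  assumes "\<And>y z. P y \<Longrightarrow> P z \<Longrightarrow> y = z"
  shows "graph_val P = Some y \<longleftrightarrow> P y"
  using assms unfolding graph_val_def by (auto intro: theI2)


section \<open>Kleene's first model\<close>

text \<open>Programs for partial recursive functions: composition, primitive recursion and
  minimisation over zero, successor and projections.  Arities are not recorded in the syntax:
  a program computes a partial function on each \<open>\<nat>\<^sup>n\<close>.\<close>

datatype recf =
    Zero
  | Succ
  | Proj nat
  | Comp recf "recf list"
  | PrimRec recf recf
  | Mu recf

inductive computes :: "recf \<Rightarrow> nat list \<Rightarrow> nat \<Rightarrow> bool"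
where
  Zero: "computes Zero xs 0"
| Succ: "computes Succ [x] (x + 1)"
| Proj: "i < length xs \<Longrightarrow> computes (Proj i) xs (xs ! i)"
| Comp: "\<lbrakk>list_all2 (\<lambda>g. computes g xs) gs ys; computes f ys z\<rbrakk> \<Longrightarrow> computes (Comp f gs) xs z"
| PrimRec_0: "computes f xs z \<Longrightarrow> computes (PrimRec f g) (0 # xs) z"
| PrimRec_Suc: "\<lbrakk>computes (PrimRec f g) (n # xs) y; computes g (n # y # xs) z\<rbrakk>
    \<Longrightarrow> computes (PrimRec f g) (Suc n # xs) z"
| Mu: "\<lbrakk>computes f (n # xs) 0; \<forall>i<n. \<exists>y. computes f (i # xs) (Suc y)\<rbrakk>
    \<Longrightarrow> computes (Mu f) xs n"

inductive_cases computes_cases: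
  "computes Zero xs y" "computes Succ xs y" "computes (Proj i) xs y" "computes (Comp f gs) xs y"
  "computes (PrimRec f g) (0 # xs) y" "computes (PrimRec f g) (Suc n # xs) y" "computes (Mu f) xs y"

lemma computes_functional: "computes f xs y \<Longrightarrow> computes f xs z \<Longrightarrow> y = z"
proof (induction arbitrary: z rule: computes.induct)
  case (Zero xs)
  then show ?case by (rule computes_cases(1)) simp
next
  case (Succ x)
  then show ?case by (rule computes_cases(2)) simp
next
  case (Proj i xs)
  from Proj(2) show ?case by (rule computes_cases(3)) simp
next
  case (Comp xs gs ys f z')
  from Comp.prems obtain ys' where ys': "list_all2 (\<lambda>g. computes g xs) gs ys'" "computes f ys' z"
    by (rule computes_cases(4))
  have "ys = ys'"
    using Comp.IH(1) ys'(1) by (auto simp: list_all2_conv_all_nth intro!: nth_equalityI)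
  then show ?case using Comp.IH(2) ys'(2) by simp
next
  case (PrimRec_0 f xs z' g)
  from PrimRec_0.prems show ?case by (rule computes_cases(5)) (rule PrimRec_0.IH)
next
  case (PrimRec_Suc f g n xs y z')
  from PrimRec_Suc.prems obtain y'
    where "computes (PrimRec f g) (n # xs) y'" "computes g (n # y' # xs) z"
    by (rule computes_cases(6))
  with PrimRec_Suc.IH show ?case by blast
next
  case (Mu f n xs)
  from Mu.prems obtain z: "computes f (z # xs) 0" "\<forall>i<z. \<exists>y. computes f (i # xs) (Suc y)"
    by (rule computes_cases(7)) blast
  have "\<not> z < n" using Mu.IH(2) z(1) by fastforce
  moreover have "\<not> n < z" using Mu.IH(1) z(2) by fastforce
  ultimately show ?case by simp
qed

text \<open>Goedel numbering of programs, relative to the primitive recursive bijection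
  \<^const>\<open>list_encode\<close> between lists of numbers and numbers.\<close>

primrec goedel :: "recf \<Rightarrow> nat"
where
  "goedel Zero = list_encode [0]"
| "goedel Succ = list_encode [1]"
| "goedel (Proj i) = list_encode [2, i]"
| "goedel (Comp f gs) = list_encode (3 # goedel f # map goedel gs)"
| "goedel (PrimRec f g) = list_encode [4, goedel f, goedel g]"
| "goedel (Mu f) = list_encode [5, goedel f]"

lemma goedel_inject: "goedel f = goedel g \<Longrightarrow> f = g"
proof (induction f arbitrary: g)
  case (Comp f gs)
  then obtain f' gs' where g: "g = Comp f' gs'"
    by (cases g) (auto dest: list_encode_inverse[THEN arg_cong, THEN trans] simp: list_encode_eq)
  with Comp.prems have "goedel f = goedel f'" "map goedel gs = map goedel gs'"
    by (auto simp: list_encode_eq)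
  moreover from this(2) have "gs = gs'"
    using Comp.IH(2) by (auto simp: list_eq_iff_nth_eq)
  ultimately show ?case using Comp.IH(1) g by simp
next
  case Zero then show ?case by (cases g) (auto simp: list_encode_eq)
next
  case Succ then show ?case by (cases g) (auto simp: list_encode_eq)
next
  case Proj then show ?case by (cases g) (auto simp: list_encode_eq)
next
  case PrimRec from PrimRec.prems show ?case
    by (cases g) (auto simp: list_encode_eq dest: PrimRec.IH)
next
  case Mu from Mu.prems show ?case
    by (cases g) (auto simp: list_encode_eq dest: Mu.IH)
qed

text \<open>The \<open>n\<close>-th unary partial recursive function; numbers that are not the Goedel number of a
  program are indices of the nowhere defined function.\<close>

definition phi :: "nat \<Rightarrow> nat \<Rightarrow> nat option"
  where "phi n m = graph_val (\<lambda>y. \<exists>f. goedel f = n \<and> computes f [m] y)"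

definition K1 :: "nat pas"
  where "K1 = phi"


section \<open>The pca \<open>A[f]\<close>\<close>

text \<open>Numerals used to express the length of a tuple inside a pca.  The numeral for \<open>0\<close> is a pair
  with first component \<open>\<T>\<close>, so that the first projection is a zero test for every choice of
  the pairing combinator.\<close>

primrec numeral_of :: "'a pas \<Rightarrow> 'a \<Rightarrow> 'a \<Rightarrow> 'a \<Rightarrow> nat \<Rightarrow> 'a option"
where
  "numeral_of A tt ff p 0 = Some p \<cdot>\<^bsub>A\<^esub> Some tt \<cdot>\<^bsub>A\<^esub> Some tt"
| "numeral_of A tt ff p (Suc n) = Some p \<cdot>\<^bsub>A\<^esub> Some ff \<cdot>\<^bsub>A\<^esub> numeral_of A tt ff p n"

definition booleans :: "'a pas \<Rightarrow> 'a \<Rightarrow> 'a \<Rightarrow> bool"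
  where "booleans A tt ff \<longleftrightarrow> (\<forall>a b.
     Some tt \<cdot>\<^bsub>A\<^esub> Some a \<cdot>\<^bsub>A\<^esub> Some b = Some a \<and>
     Some ff \<cdot>\<^bsub>A\<^esub> Some a \<cdot>\<^bsub>A\<^esub> Some b = Some b)"

definition pairing :: "'a pas \<Rightarrow> 'a \<Rightarrow> bool"
  where "pairing A p \<longleftrightarrow> (\<exists>p0 p1. \<forall>a b.
     Some p0 \<cdot>\<^bsub>A\<^esub> (Some p \<cdot>\<^bsub>A\<^esub> Some a \<cdot>\<^bsub>A\<^esub> Some b) = Some a \<and>
     Some p1 \<cdot>\<^bsub>A\<^esub> (Some p \<cdot>\<^bsub>A\<^esub> Some a \<cdot>\<^bsub>A\<^esub> Some b) = Some b)"

text \<open>\<open>code us\<close> is the element \<open>[u\<^sub>0,\<dots>,u\<^sub>n]\<close>.  Besides concatenation, length and projections,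
  the formation of one-element tuples must be computable: otherwise the code of an argument could
  carry uncomputable information about it.\<close>

definition tuple_coding :: "'a pas \<Rightarrow> 'a \<Rightarrow> 'a \<Rightarrow> 'a \<Rightarrow> ('a list \<Rightarrow> 'a) \<Rightarrow> bool"
  where "tuple_coding A tt ff p code \<longleftrightarrow>
     (\<exists>single. \<forall>a. Some single \<cdot>\<^bsub>A\<^esub> Some a = Some (code [a])) \<and>
     (\<exists>conc. \<forall>us vs.
        Some conc \<cdot>\<^bsub>A\<^esub> Some (code us) \<cdot>\<^bsub>A\<^esub> Some (code vs) = Some (code (us @ vs))) \<and>
     (\<exists>len. \<forall>us. Some len \<cdot>\<^bsub>A\<^esub> Some (code us) = numeral_of A tt ff p (length us)) \<and>
     (\<exists>proj. \<forall>us. \<forall>i<length us.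
        Some proj \<cdot>\<^bsub>A\<^esub> Some (code us) \<cdot>\<^bsub>A\<^esub> numeral_of A tt ff p i = Some (us ! i))"

definition standard_data :: "'a pas \<Rightarrow> 'a \<Rightarrow> 'a \<Rightarrow> 'a \<Rightarrow> ('a list \<Rightarrow> 'a) \<Rightarrow> bool"
  where "standard_data A tt ff p code \<longleftrightarrow>
     booleans A tt ff \<and> pairing A p \<and> tuple_coding A tt ff p code"

definition dialogue ::
    "'a pas \<Rightarrow> 'a \<Rightarrow> 'a \<Rightarrow> ('a list \<Rightarrow> 'a) \<Rightarrow> ('a \<rightharpoonup> 'a) \<Rightarrow> 'a \<Rightarrow> 'a \<Rightarrow> 'a list \<Rightarrow> bool"
  where "dialogue A ff p code f a b us \<longleftrightarrow>
     (\<forall>i<length us. \<exists>v x.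
        A a (code ([b] @ take i us)) = Some x \<and>
        Some p \<cdot>\<^bsub>A\<^esub> Some ff \<cdot>\<^bsub>A\<^esub> Some v = Some x \<and>
        f v = Some (us ! i))"

definition rel_app_graph ::
    "'a pas \<Rightarrow> 'a \<Rightarrow> 'a \<Rightarrow> 'a \<Rightarrow> ('a list \<Rightarrow> 'a) \<Rightarrow> ('a \<rightharpoonup> 'a) \<Rightarrow> 'a \<Rightarrow> 'a \<Rightarrow> 'a \<Rightarrow> bool"
  where "rel_app_graph A tt ff p code f a b c \<longleftrightarrow>
     (\<exists>us x. dialogue A ff p code f a b us \<and>
        A a (code ([b] @ us)) = Some x \<and>
        Some p \<cdot>\<^bsub>A\<^esub> Some tt \<cdot>\<^bsub>A\<^esub> Some c = Some x)"

definition rel_pca ::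
    "'a pas \<Rightarrow> 'a \<Rightarrow> 'a \<Rightarrow> 'a \<Rightarrow> ('a list \<Rightarrow> 'a) \<Rightarrow> ('a \<rightharpoonup> 'a) \<Rightarrow> 'a pas"
  where "rel_pca A tt ff p code f a b = graph_val (rel_app_graph A tt ff p code f a b)"

lemma rel_app_graph_functional:
  assumes data: "standard_data A tt ff p code"
    and c: "rel_app_graph A tt ff p code f a b c"
    and d: "rel_app_graph A tt ff p code f a b d"
  shows "c = d"
proof (cases "tt = ff")
  case True
  have "Some tt \<cdot>\<^bsub>A\<^esub> Some c \<cdot>\<^bsub>A\<^esub> Some d = Some c"
    "Some ff \<cdot>\<^bsub>A\<^esub> Some c \<cdot>\<^bsub>A\<^esub> Some d = Some d"
    using data unfolding standard_data_def booleans_def by blast+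
  with True show ?thesis by simp
next
  case False
  obtain p0 p1 where pr: "\<forall>a b.
       Some p0 \<cdot>\<^bsub>A\<^esub> (Some p \<cdot>\<^bsub>A\<^esub> Some a \<cdot>\<^bsub>A\<^esub> Some b) = Some a \<and>
       Some p1 \<cdot>\<^bsub>A\<^esub> (Some p \<cdot>\<^bsub>A\<^esub> Some a \<cdot>\<^bsub>A\<^esub> Some b) = Some b"
    using data unfolding standard_data_def pairing_def by (elim conjE exE)
  have inj: "a = a' \<and> b = b'"
    if "Some p \<cdot>\<^bsub>A\<^esub> Some a \<cdot>\<^bsub>A\<^esub> Some b = Some x" "Some p \<cdot>\<^bsub>A\<^esub> Some a' \<cdot>\<^bsub>A\<^esub> Some b' = Some x"
    for a b a' b' x
    using pr[rule_format, of a b] pr[rule_format, of a' b'] that by simp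
  obtain us x where us: "dialogue A ff p code f a b us"
      "A a (code ([b] @ us)) = Some x" "Some p \<cdot>\<^bsub>A\<^esub> Some tt \<cdot>\<^bsub>A\<^esub> Some c = Some x"
    using c unfolding rel_app_graph_def by blast
  obtain vs y where vs: "dialogue A ff p code f a b vs"
      "A a (code ([b] @ vs)) = Some y" "Some p \<cdot>\<^bsub>A\<^esub> Some tt \<cdot>\<^bsub>A\<^esub> Some d = Some y"
    using d unfolding rel_app_graph_def by blast
  have agree: "take i us = take i vs" if "i \<le> length us" "i \<le> length vs" for i
    using that
  proof (induction i)
    case (Suc i)
    then have IH: "take i us = take i vs" by simp
    obtain v x where v: "A a (code ([b] @ take i us)) = Some x"
        "Some p \<cdot>\<^bsub>A\<^esub> Some ff \<cdot>\<^bsub>A\<^esub> Some v = Some x" "f v = Some (us ! i)"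
      using us(1) Suc.prems unfolding dialogue_def by (meson Suc_le_lessD)
    obtain w y where w: "A a (code ([b] @ take i vs)) = Some y"
        "Some p \<cdot>\<^bsub>A\<^esub> Some ff \<cdot>\<^bsub>A\<^esub> Some w = Some y" "f w = Some (vs ! i)"
      using vs(1) Suc.prems unfolding dialogue_def by (meson Suc_le_lessD)
    have "x = y" using v(1) w(1) IH by simp
    then have "v = w" using inj[OF v(2)] w(2) by simp
    then have "us ! i = vs ! i" using v(3) w(3) by simp
    with IH Suc.prems show ?case by (simp add: take_Suc_conv_app_nth)
  qed simp
  have stop: "\<not> length us' < length vs'"
    if pre: "take (length us') us' = take (length us') vs'"
      and fin: "A a (code ([b] @ us')) = Some z" "Some p \<cdot>\<^bsub>A\<^esub> Some tt \<cdot>\<^bsub>A\<^esub> Some e = Some z"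
      and dial: "dialogue A ff p code f a b vs'" for us' vs' z e
  proof
    assume "length us' < length vs'"
    then obtain v x where v: "A a (code ([b] @ take (length us') vs')) = Some x"
        "Some p \<cdot>\<^bsub>A\<^esub> Some ff \<cdot>\<^bsub>A\<^esub> Some v = Some x"
      using dial unfolding dialogue_def by blast
    have "x = z" using pre fin(1) v(1) by simp
    then show False using inj[OF v(2)] fin(2) False by blast
  qed
  have "\<not> length us < length vs"
    using stop[OF _ us(2,3) vs(1)] agree[of "length us"] by fastforce
  moreover have "\<not> length vs < length us"
    using stop[OF _ vs(2,3) us(1)] agree[of "length vs"] by fastforce
  ultimately have eq: "us = vs" using agree[of "length us"] by simp
  then have "x = y" using us(2) vs(2) by simp
  then show ?thesis using inj[OF us(3)] vs(3) by blast
qed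


section \<open>The pca \<open>A[F]\<close>\<close>

definition next_stage ::
    "'a pas \<Rightarrow> 'a \<Rightarrow> 'a \<Rightarrow> 'a \<Rightarrow> ('a list \<Rightarrow> 'a) \<Rightarrow> (('a \<Rightarrow> 'a) \<Rightarrow> 'a option) \<Rightarrow> ('a \<rightharpoonup> 'a) \<Rightarrow> ('a \<rightharpoonup> 'a)"
  where "next_stage A tt ff p code F f a =
     graph_val (\<lambda>b. \<exists>g. (\<forall>x. rel_pca A tt ff p code f a x = Some (g x)) \<and> F g = Some b)"

definition union_map :: "('a \<rightharpoonup> 'b) set \<Rightarrow> ('a \<rightharpoonup> 'b)"
  where "union_map M a = graph_val (\<lambda>b. \<exists>m\<in>M. m a = Some b)"

text \<open>The ordinals \<open>\<alpha>\<close> indexing the stages are the elements of a well-order of type \<open>|A|\<^sup>+\<close>,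
  \<open>A\<close> being the set of all elements of type \<open>'a\<close>.  Nothing is lost by this bound: the stages
  increase, and as long as they do so strictly each of them adds a new argument in \<open>A\<close> to the
  domain, so they are constant from some ordinal below \<open>|A|\<^sup>+\<close> on.\<close>

abbreviation ordinals :: "'a set rel"
  where "ordinals \<equiv> cardSuc (card_of (UNIV :: 'a set))"

definition is_successor :: "'b rel \<Rightarrow> 'b \<Rightarrow> 'b \<Rightarrow> bool"
  where "is_successor r \<beta> \<alpha> \<longleftrightarrow> \<beta> \<in> underS r \<alpha> \<and> (\<forall>\<gamma> \<in> underS r \<alpha>. (\<gamma>, \<beta>) \<in> r)"

definition stage_rec ::
    "'a pas \<Rightarrow> 'a \<Rightarrow> 'a \<Rightarrow> 'a \<Rightarrow> ('a list \<Rightarrow> 'a) \<Rightarrow> (('a \<Rightarrow> 'a) \<Rightarrow> 'a option)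
      \<Rightarrow> ('a set \<Rightarrow> ('a \<rightharpoonup> 'a)) \<Rightarrow> 'a set \<Rightarrow> ('a \<rightharpoonup> 'a)"
  where "stage_rec A tt ff p code F S \<alpha> =
     (if underS ordinals \<alpha> = {} then Map.empty
      else if \<exists>\<beta>. is_successor ordinals \<beta> \<alpha>
        then next_stage A tt ff p code F (S (THE \<beta>. is_successor ordinals \<beta> \<alpha>))
      else union_map (S ` underS ordinals \<alpha>))"

definition stage ::
    "'a pas \<Rightarrow> 'a \<Rightarrow> 'a \<Rightarrow> 'a \<Rightarrow> ('a list \<Rightarrow> 'a) \<Rightarrow> (('a \<Rightarrow> 'a) \<Rightarrow> 'a option)
      \<Rightarrow> 'a set \<Rightarrow> ('a \<rightharpoonup> 'a)"
  where "stage A tt ff p code F = wo_rel.worec ordinals (stage_rec A tt ff p code F)"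

lemma wo_rel_ordinals: "wo_rel (ordinals :: 'a set rel)"
  by (simp add: wo_rel_def cardSuc_Card_order card_of_Card_order card_order_on_well_order_on)

lemma is_successor_unique:
  assumes "wo_rel r" "is_successor r \<beta> \<alpha>" "is_successor r \<gamma> \<alpha>"
  shows "\<beta> = \<gamma>"
  using assms wo_rel.ANTISYM[OF assms(1)] unfolding is_successor_def antisym_def by blast

lemma the_is_successor:
  assumes "wo_rel r" "is_successor r \<beta> \<alpha>"
  shows "(THE \<beta>. is_successor r \<beta> \<alpha>) = \<beta>"
  using assms(2) by (rule the_equality) (rule is_successor_unique[OF assms(1) _ assms(2)])

lemma stage_unfold:
  "stage A tt ff p code F \<alpha> = stage_rec A tt ff p code F (stage A tt ff p code F) \<alpha>"
proof -
  have "wo_rel.adm_wo ordinals (stage_rec A tt ff p code F)"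
    unfolding wo_rel.adm_wo_def[OF wo_rel_ordinals]
  proof (intro allI impI)
    fix f g :: "'a set \<Rightarrow> 'a \<rightharpoonup> 'a" and \<alpha> :: "'a set"
    assume eq: "\<forall>y \<in> underS ordinals \<alpha>. f y = g y"
    have "f (THE \<beta>. is_successor ordinals \<beta> \<alpha>) = g (THE \<beta>. is_successor ordinals \<beta> \<alpha>)"
      if "\<exists>\<beta>. is_successor ordinals \<beta> \<alpha>"
    proof -
      from that obtain \<beta> where b: "is_successor ordinals \<beta> \<alpha>" ..
      then have "(THE \<beta>. is_successor ordinals \<beta> \<alpha>) = \<beta>"
        by (rule the_is_successor[OF wo_rel_ordinals])
      with b eq show ?thesis unfolding is_successor_def by simp
    qed
    moreover have "f ` underS ordinals \<alpha> = g ` underS ordinals \<alpha>"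
      using eq by (intro image_cong) auto
    ultimately show "stage_rec A tt ff p code F f \<alpha> = stage_rec A tt ff p code F g \<alpha>"
      unfolding stage_rec_def by auto
  qed
  from wo_rel.worec_fixpoint[OF wo_rel_ordinals this] show ?thesis
    unfolding stage_def by (rule fun_cong)
qed

lemma stage_zero: "underS ordinals \<alpha> = {} \<Longrightarrow> stage A tt ff p code F \<alpha> = Map.empty"
  by (subst stage_unfold) (simp add: stage_rec_def)

lemma stage_successor:
  assumes "is_successor ordinals \<beta> \<alpha>"
  shows "stage A tt ff p code F \<alpha> = next_stage A tt ff p code F (stage A tt ff p code F \<beta>)"
proof -
  have "(THE \<beta>. is_successor ordinals \<beta> \<alpha>) = \<beta>"
    using assms by (rule the_is_successor[OF wo_rel_ordinals])
  moreover have "underS ordinals \<alpha> \<noteq> {}" using assms unfolding is_successor_def by blast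
  ultimately show ?thesis using assms by (subst stage_unfold) (auto simp: stage_rec_def)
qed

lemma stage_limit:
  assumes "underS ordinals \<alpha> \<noteq> {}" "\<nexists>\<beta>. is_successor ordinals \<beta> \<alpha>"
  shows "stage A tt ff p code F \<alpha> = union_map (stage A tt ff p code F ` underS ordinals \<alpha>)"
  using assms by (subst stage_unfold) (simp add: stage_rec_def)

definition functional_map ::
    "'a pas \<Rightarrow> 'a \<Rightarrow> 'a \<Rightarrow> 'a \<Rightarrow> ('a list \<Rightarrow> 'a) \<Rightarrow> (('a \<Rightarrow> 'a) \<Rightarrow> 'a option) \<Rightarrow> ('a \<rightharpoonup> 'a)"
  where "functional_map A tt ff p code F =
     union_map (stage A tt ff p code F ` Field ordinals)"

definition functional_pca ::
    "'a pas \<Rightarrow> 'a \<Rightarrow> 'a \<Rightarrow> 'a \<Rightarrow> ('a list \<Rightarrow> 'a) \<Rightarrow> (('a \<Rightarrow> 'a) \<Rightarrow> 'a option) \<Rightarrow> 'a pas"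
  where "functional_pca A tt ff p code F =
     rel_pca A tt ff p code (functional_map A tt ff p code F)"


section \<open>The pca \<open>K\<^sub>1\<^sup>F\<close>\<close>

text \<open>\<open>kleene F e ns y\<close> means \<open>{e}(ns) = y\<close>.  Kleene's \<open>S7\<close>, which concerns function
  arguments, is absent.  In \<open>S6\<close>, list positions count from \<open>0\<close>, so that \<open>ns ! k\<close> is
  \<open>n\<^bsub>k+1\<^esub>\<close>.\<close>

inductive kleene :: "((nat \<Rightarrow> nat) \<Rightarrow> nat) \<Rightarrow> nat \<Rightarrow> nat list \<Rightarrow> nat \<Rightarrow> bool"
  for F :: "(nat \<Rightarrow> nat) \<Rightarrow> nat"
where
  S1: "kleene F (list_encode [1, 1]) [n] (n + 1)"
| S2: "kleene F (list_encode [2, 1, m]) [n] m"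
| S3: "length ns = m \<Longrightarrow> 1 \<le> m \<Longrightarrow> kleene F (list_encode [3, m]) ns (ns ! 0)"
| S4: "\<lbrakk>length ns = k; kleene F h ns y; kleene F g (y # ns) z\<rbrakk>
    \<Longrightarrow> kleene F (list_encode [4, k, g, h]) ns z"
| S5_0: "kleene F g [n] z \<Longrightarrow> kleene F (list_encode [5, 2, g, h]) [0, n] z"
| S5_Suc: "\<lbrakk>kleene F (list_encode [5, 2, g, h]) [k, n] y; kleene F h [k, y, n] z\<rbrakk>
    \<Longrightarrow> kleene F (list_encode [5, 2, g, h]) [k + 1, n] z"
| S6: "\<lbrakk>length ns = r; 1 \<le> k; k < r; kleene F g (ns ! k # take k ns @ drop (k + 1) ns) z\<rbrakk>
    \<Longrightarrow> kleene F (list_encode [6, r, k, g]) ns z"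
| S8: "(\<forall>k. kleene F h [k, n] (g k)) \<Longrightarrow> kleene F (list_encode [8, 1, h]) [n] (F g)"
| S9: "\<lbrakk>length ns = k + l; kleene F m (take k ns) z\<rbrakk>
    \<Longrightarrow> kleene F (list_encode [9, k, l]) (m # ns) z"

lemma kleene_functional: "kleene F e ns y \<Longrightarrow> kleene F e ns z \<Longrightarrow> y = z"
proof (induction arbitrary: z rule: kleene.induct)
  case (S1 n)
  then show ?case by (rule kleene.cases) (simp_all add: list_encode_eq del: list_encode.simps)
next
  case (S2 m n)
  then show ?case by (rule kleene.cases) (simp_all add: list_encode_eq del: list_encode.simps)
next
  case (S3 ns m)
  from S3(3) show ?case by (rule kleene.cases) (simp_all add: list_encode_eq del: list_encode.simps)
next
  case (S4 ns k h y g z')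
  from S4.prems obtain y' where "kleene F h ns y'" "kleene F g (y' # ns) z"
    by (rule kleene.cases) (simp_all add: list_encode_eq del: list_encode.simps)
  with S4.IH show ?case by blast
next
  case (S5_0 g n z' h)
  from S5_0.prems have "kleene F g [n] z"
    by (rule kleene.cases) (simp_all add: list_encode_eq del: list_encode.simps)
  with S5_0.IH show ?case by blast
next
  case (S5_Suc g h k n y z')
  from S5_Suc.prems obtain y' where
    "kleene F (list_encode [5, 2, g, h]) [k, n] y'" "kleene F h [k, y', n] z"
    by (rule kleene.cases) (simp_all add: list_encode_eq del: list_encode.simps)
  with S5_Suc.IH show ?case by blast
next
  case (S6 ns r k g z')
  from S6.prems have "kleene F g (ns ! k # take k ns @ drop (k + 1) ns) z"
    by (rule kleene.cases) (simp_all add: list_encode_eq del: list_encode.simps)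
  with S6.IH show ?case by blast
next
  case (S8 h n g)
  from S8.prems obtain g' where g': "\<forall>k. kleene F h [k, n] (g' k)" "z = F g'"
    by (rule kleene.cases) (simp_all add: list_encode_eq del: list_encode.simps)
  have "g = g'" using S8.IH g'(1) by blast
  with g'(2) show ?case by simp
next
  case (S9 ns k l m z')
  from S9.prems have "kleene F m (take k ns) z"
    by (rule kleene.cases) (simp_all add: list_encode_eq del: list_encode.simps)
  with S9.IH show ?case by blast
qed

definition kleene_pca :: "((nat \<Rightarrow> nat) \<Rightarrow> nat) \<Rightarrow> nat pas"
  where "kleene_pca F e n = graph_val (kleene F e [n])"

end

theory Submission
  imports Defs
begin

text \<open>Both structures have the natural numbers as elements, and the isomorphism is the identity relation
in both directions. What has to be shown is that the application of each structure is computable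
inside the other one. Only defined values have to be preserved, so an interpreter may well converge
where the interpreted application does not; every simulation below is an implication from
``defined'' to ``defined with the same value''.

The argument isolates what the two structures have in common. An application on \<open>\<nat>\<close> is called
effective (locale \<open>effective_pas\<close>) if it represents all partial recursive functions, is closed
under composition, has a universal element and satisfies the s-m-n theorem with a recursive index
function. Kleene's recursion theorem (\<open>recursion\<close>) follows, so that functions may be programmed by
unrestricted recursion and case distinction; in particular every effective structure is a pca. It
has an oracle for \<open>F\<close> (\<open>effective_pas_with_oracle\<close>) if some element sends each index of a total
function \<open>g\<close> to \<open>F g\<close>. Both \<open>K\<^sub>1[F]\<close> and \<open>K\<^sub>1\<^sup>F\<close> are the least structures of this kind:
their applications are computable in every effective structure \<open>X\<close> with an oracle for \<open>F\<close>.

\<^item> For \<open>K\<^sub>1[F]\<close> (\<open>programmable_functional_pca\<close>) the interpreter conducts the dialogue. If a query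
\<open>v\<close> comes up, it asks the oracle of \<open>X\<close> about an index for the interpreted function
\<open>k \<mapsto> v \<cdot> k\<close>. It is correct by induction on the stage at which a value of the functional
map appears.

\<^item> For \<open>K\<^sub>1\<^sup>F\<close> (\<open>programmable_kleene_pca\<close>) the interpreter distinguishes the scheme from which
the index is built, and is correct by induction on computations.

Using each of these inside the other structure yields the theorem, provided that both structures
are effective with an oracle.

\<^item> For \<open>K\<^sub>1[f]\<close> with an arbitrary \<open>f\<close> (\<open>effective_app\<close>) this is programming with dialogues in
\<open>K\<^sub>1\<close>, which itself is effective by a universal machine. The oracle is the program that
asks its argument and returns the reply. It works because the functional map is closed under the
passage to the next stage (\<open>next_limit_map\<close>): the graph of the functional map is countable, so it
is exhausted at one of the stages, as these are indexed by a regular uncountable cardinal.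

\<^item> For \<open>K\<^sub>1\<^sup>F\<close> (\<open>effective_kleene_pca\<close>) the obstacle is that S1, S2 and S5 admit no passive
arguments. A function of three or more arguments that is defined by the schemes takes the value \<open>0\<close>
at \<open>(0, 0, 0, \<dots>)\<close> if it takes any, so nonzero constants are not available there. The remedy is to
carry an index of the successor function along as an additional first argument. From it all other
constants can be generated with the help of S9, and a recursion with parameters is obtained by
passing an index to itself.\<close>

section \<open>Recursive functions\<close>

definition npair :: "nat \<Rightarrow> nat \<Rightarrow> nat"  ("\<langle>_,/ _\<rangle>")
  where "\<langle>a, b\<rangle> = prod_encode (a, b)"

definition nfst :: "nat \<Rightarrow> nat"
  where "nfst n = fst (prod_decode n)"

definition nsnd :: "nat \<Rightarrow> nat"
  where "nsnd n = snd (prod_decode n)"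

text \<open>The constructor of the coding of lists by \<^const>\<open>list_encode\<close>; the empty list has code \<open>0\<close>.\<close>

definition ncons :: "nat \<Rightarrow> nat \<Rightarrow> nat"
  where "ncons a b = Suc \<langle>a, b\<rangle>"

definition nhd :: "nat \<Rightarrow> nat"
  where "nhd n = nfst (n - 1)"

definition ntl :: "nat \<Rightarrow> nat"
  where "ntl n = nsnd (n - 1)"

lemma nfst_npair [simp]: "nfst \<langle>a, b\<rangle> = a" and nsnd_npair [simp]: "nsnd \<langle>a, b\<rangle> = b"
  by (simp_all add: npair_def nfst_def nsnd_def)

lemma npair_inject [simp]: "\<langle>a, b\<rangle> = \<langle>c, d\<rangle> \<longleftrightarrow> a = c \<and> b = d"
  by (simp add: npair_def)

lemma nhd_ncons [simp]: "nhd (ncons a b) = a" and ntl_ncons [simp]: "ntl (ncons a b) = b"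
  by (simp_all add: ncons_def nhd_def ntl_def)

lemma ncons_not_0 [simp]: "ncons a b \<noteq> 0" "0 < ncons a b"
  by (simp_all add: ncons_def)

lemma list_encode_Cons: "list_encode (x # xs) = ncons x (list_encode xs)"
  by (simp add: ncons_def npair_def)

lemma list_encode_Nil: "list_encode [] = 0"
  by simp

declare list_encode.simps [simp del]

lemmas list_encode_ncons [simp] = list_encode_Nil list_encode_Cons

text \<open>Recursive functions are total here. Apart from the basic arithmetic, functions of several arguments
are treated as unary functions of an environment, a number from which the arguments are obtained
by projections. The closure properties can then be applied to an expression in the
environment by syntax-directed backward reasoning.\<close>

definition recursive :: "(nat \<Rightarrow> nat) \<Rightarrow> bool"
  where "recursive t \<longleftrightarrow> (\<exists>P. \<forall>n. computes P [n] (t n))"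

definition recursive2 :: "(nat \<Rightarrow> nat \<Rightarrow> nat) \<Rightarrow> bool"
  where "recursive2 t \<longleftrightarrow> (\<exists>P. \<forall>m n. computes P [m, n] (t m n))"

lemma computes_Comp1: "computes P xs y \<Longrightarrow> computes Q [y] z \<Longrightarrow> computes (Comp Q [P]) xs z"
  by (rule computes.Comp[of _ _ "[y]"]) simp_all

lemma computes_Comp2:
  "computes P1 xs y1 \<Longrightarrow> computes P2 xs y2 \<Longrightarrow> computes Q [y1, y2] z
    \<Longrightarrow> computes (Comp Q [P1, P2]) xs z"
  by (rule computes.Comp[of _ _ "[y1, y2]"]) simp_all

lemma computes_Proj_0: "computes (Proj 0) (x # xs) x"
  and computes_Proj_1: "computes (Proj (Suc 0)) (x # y # xs) y"
  and computes_Proj_2: "computes (Proj (Suc (Suc 0))) (x # y # z # xs) z"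
  using computes.Proj[of 0 "x # xs"] computes.Proj[of 1 "x # y # xs"]
    computes.Proj[of 2 "x # y # z # xs"] by (simp_all add: numeral_2_eq_2)

lemmas computes_Projs = computes_Proj_0 computes_Proj_1 computes_Proj_2

lemma computes_Succ: "computes Succ [x] (Suc x)"
  using computes.Succ[of x] by simp

lemma recursive_comp: "recursive t \<Longrightarrow> recursive s \<Longrightarrow> recursive (\<lambda>n. t (s n))"
  unfolding recursive_def using computes_Comp1 by meson

lemma recursive_comp2:
  "recursive2 t \<Longrightarrow> recursive r \<Longrightarrow> recursive s \<Longrightarrow> recursive (\<lambda>n. t (r n) (s n))"
  unfolding recursive_def recursive2_def using computes_Comp2 by meson

lemma recursive_id: "recursive (\<lambda>n. n)"
  unfolding recursive_def using computes_Proj_0 by blast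

lemma computes_PrimRec:
  assumes "computes P xs a"
    and "\<And>k y. computes Q (k # y # xs) (h k y)"
  shows "computes (PrimRec P Q) (n # xs) (rec_nat a h n)"
  by (induction n) (use assms in \<open>auto intro: computes.PrimRec_0 computes.PrimRec_Suc\<close>)

lemma recursive_Suc: "recursive t \<Longrightarrow> recursive (\<lambda>n. Suc (t n))"
  by (rule recursive_comp[of Suc]) (auto simp: recursive_def intro: computes_Succ)

lemma recursive_const: "recursive (\<lambda>n. c)"
proof (induction c)
  case 0
  show ?case unfolding recursive_def using computes.Zero by blast
qed (rule recursive_Suc)

lemma recursive2_add: "recursive2 (+)"
proof -
  have "computes (PrimRec (Proj 0) (Comp Succ [Proj 1])) [m, n] (rec_nat n (\<lambda>k y. Suc y) m)" for m n
    by (rule computes_PrimRec) (auto intro: computes_Projs computes_Comp1 computes_Succ)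
  moreover have "rec_nat n (\<lambda>k y. Suc y) m = m + n" for m n :: nat
    by (induction m) auto
  ultimately show ?thesis unfolding recursive2_def by auto
qed

lemma recursive_pred: "recursive (\<lambda>n. n - 1)"
proof -
  have "computes (PrimRec Zero (Proj 0)) [n] (rec_nat 0 (\<lambda>k y. k) n)" for n
    by (rule computes_PrimRec) (auto intro: computes_Projs computes.Zero)
  moreover have "rec_nat 0 (\<lambda>k y. k) n = n - 1" for n :: nat
    by (cases n) auto
  ultimately show ?thesis unfolding recursive_def by auto
qed

lemma recursive2_diff: "recursive2 (\<lambda>m n. n - m)"
proof -
  obtain P where P: "\<And>n. computes P [n] (n - 1)"
    using recursive_pred unfolding recursive_def by blast
  have "computes (PrimRec (Proj 0) (Comp P [Proj 1])) [m, n] (rec_nat n (\<lambda>k y. y - 1) m)" for m n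
    by (rule computes_PrimRec) (auto intro: computes_Projs computes_Comp1 P[simplified])
  moreover have "rec_nat n (\<lambda>k y. y - 1) m = n - m" for m n :: nat
    by (induction m) auto
  ultimately show ?thesis unfolding recursive2_def by auto
qed

lemma recursive_add: "recursive s \<Longrightarrow> recursive t \<Longrightarrow> recursive (\<lambda>n. s n + t n)"
  by (rule recursive_comp2[OF recursive2_add])

lemma recursive_diff: "recursive s \<Longrightarrow> recursive t \<Longrightarrow> recursive (\<lambda>n. s n - t n)"
  using recursive_comp2[OF recursive2_diff] .

lemma recursive_triangle: "recursive t \<Longrightarrow> recursive (\<lambda>n. triangle (t n))"
proof (rule recursive_comp[of triangle])
  obtain P where P: "\<And>m n. computes P [m, n] (m + n)"
    using recursive2_add unfolding recursive2_def by blast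
  have "computes (PrimRec Zero (Comp P [Proj 1, Comp Succ [Proj 0]])) [n]
      (rec_nat 0 (\<lambda>k y. y + Suc k) n)" for n
    by (rule computes_PrimRec)
      (auto intro!: computes_Projs computes_Comp1 computes_Comp2 P[simplified] computes_Succ computes.Zero
        simp del: add_Suc_right)
  moreover have "rec_nat 0 (\<lambda>k y. y + Suc k) n = triangle n" for n :: nat
    by (induction n) auto
  ultimately show "recursive triangle" unfolding recursive_def by auto
qed

lemma npair_eq: "\<langle>a, b\<rangle> = triangle (a + b) + a"
  by (simp add: npair_def prod_encode_def)

lemma recursive_npair: "recursive s \<Longrightarrow> recursive t \<Longrightarrow> recursive (\<lambda>n. \<langle>s n, t n\<rangle>)"
  unfolding npair_eq by (intro recursive_add recursive_triangle)

lemma recursive2_npair: "recursive2 npair"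
proof -
  obtain P Q where P: "\<And>m n. computes P [m, n] (m + n)" and Q: "\<And>n. computes Q [n] (triangle n)"
    using recursive2_add recursive_triangle[OF recursive_id]
    unfolding recursive_def recursive2_def by blast
  have "computes (Comp P [Comp Q [P], Proj 0]) [m, n] \<langle>m, n\<rangle>" for m n
    unfolding npair_eq by (rule computes_Comp2[OF computes_Comp1[OF P Q] computes_Proj_0 P])
  then show ?thesis unfolding recursive2_def by blast
qed

text \<open>Undoing the pairing function needs a search for the diagonal on which a number lies.\<close>

lemma recursive_diagonal: "recursive (\<lambda>n. nfst n + nsnd n)"
proof -
  obtain P Q where P: "\<And>m n. computes P [m, n] (n - m)"
    and Q: "\<And>n. computes Q [n] (triangle (Suc n))"
    using recursive2_diff recursive_triangle[OF recursive_Suc[OF recursive_id]]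
    unfolding recursive_def recursive2_def by blast
  define R where "R = Comp P [Comp Q [Proj 0], Comp Succ [Proj 1]]"
  have R: "computes R [k, n] (Suc n - triangle (Suc k))" for k n
    unfolding R_def using P Q
    by (auto intro!: computes_Comp2 computes_Comp1 P Q computes_Projs computes_Succ
        simp del: triangle_Suc)
  have "computes (Mu R) [n] (nfst n + nsnd n)" for n
  proof -
    obtain a b where n: "n = \<langle>a, b\<rangle>"
      by (metis npair_def prod_decode_inverse surj_pair)
    \<comment> \<open>The numbers on the diagonal \<open>k = a + b\<close> lie between \<open>triangle k\<close> and \<open>triangle (Suc k)\<close>.\<close>
    have "Suc n - triangle (Suc (a + b)) = 0"
      by (simp add: n npair_eq)
    then have "computes R [a + b, n] 0" using R by metis
    moreover have "\<exists>y. computes R [i, n] (Suc y)" if "i < a + b" for i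
    proof -
      have "mono triangle" by (simp add: mono_iff_le_Suc)
      then have "triangle (Suc i) \<le> triangle (a + b)"
        by (rule monoD) (use that in simp)
      then have "Suc n - triangle (Suc i) = Suc (n - triangle (Suc i))"
        using n npair_eq by (intro Suc_diff_le) auto
      then show ?thesis using R by metis
    qed
    ultimately show ?thesis unfolding n by (auto intro!: computes.Mu)
  qed
  then show ?thesis unfolding recursive_def by blast
qed

lemma recursive_nfst: "recursive t \<Longrightarrow> recursive (\<lambda>n. nfst (t n))"
proof (rule recursive_comp[of nfst])
  have "nfst n = n - triangle (nfst n + nsnd n)" for n
    by (metis add_diff_cancel_left' nfst_def npair_def npair_eq nsnd_def prod.collapse prod_decode_inverse)
  moreover have "recursive (\<lambda>n. n - triangle (nfst n + nsnd n))"
    by (intro recursive_diff recursive_triangle recursive_id recursive_diagonal)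
  ultimately show "recursive nfst" by presburger
qed

lemma recursive_nsnd: "recursive t \<Longrightarrow> recursive (\<lambda>n. nsnd (t n))"
proof (rule recursive_comp[of nsnd])
  have "recursive (\<lambda>n. (nfst n + nsnd n) - nfst n)"
    by (intro recursive_diff recursive_nfst recursive_id recursive_diagonal)
  then show "recursive nsnd" by simp
qed

lemma recursive_ncons: "recursive s \<Longrightarrow> recursive t \<Longrightarrow> recursive (\<lambda>n. ncons (s n) (t n))"
  unfolding ncons_def by (intro recursive_Suc recursive_npair)

lemma recursive_nhd: "recursive t \<Longrightarrow> recursive (\<lambda>n. nhd (t n))"
  unfolding nhd_def by (intro recursive_nfst recursive_diff recursive_const)

lemma recursive_ntl: "recursive t \<Longrightarrow> recursive (\<lambda>n. ntl (t n))"
  unfolding ntl_def by (intro recursive_nsnd recursive_diff recursive_const)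

lemma recursive_rec:
  assumes "recursive g" "recursive (\<lambda>m. h (nfst (nsnd m)) (nfst m) (nsnd (nsnd m)))" "recursive k"
  shows "recursive (\<lambda>n. rec_nat (g n) (\<lambda>i y. h i y n) (k n))"
proof -
  obtain P Q R where P: "\<And>n. computes P [n] (g n)" and R: "\<And>n. computes R [n] (k n)"
    and Q: "\<And>m. computes Q [m] (h (nfst (nsnd m)) (nfst m) (nsnd (nsnd m)))"
    using assms unfolding recursive_def by blast
  obtain C where C: "\<And>m n. computes C [m, n] \<langle>m, n\<rangle>"
    using recursive2_npair unfolding recursive2_def by blast
  have "computes (Comp Q [Comp C [Proj 1, Comp C [Proj 0, Proj 2]]]) [i, y, n] (h i y n)" for i y n
    using Q[of "\<langle>y, \<langle>i, n\<rangle>\<rangle>"]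
    by (auto simp: numeral_2_eq_2 intro!: computes_Comp1 computes_Comp2 C computes_Projs)
  then have "computes (Comp (PrimRec P (Comp Q [Comp C [Proj 1, Comp C [Proj 0, Proj 2]]])) [R, Proj 0]) [n]
      (rec_nat (g n) (\<lambda>i y. h i y n) (k n))" for n
    by (rule computes_Comp2[OF R computes_Proj_0 computes_PrimRec[OF P]])
  then show ?thesis unfolding recursive_def by blast
qed

lemma recursive_funpow:
  assumes "recursive g" "recursive (\<lambda>m. h (nsnd m) (nfst m))" "recursive k"
  shows "recursive (\<lambda>n. (h n ^^ k n) (g n))"
proof -
  have "recursive (\<lambda>m. h (nsnd \<langle>nfst m, nsnd (nsnd m)\<rangle>) (nfst \<langle>nfst m, nsnd (nsnd m)\<rangle>))"
    by (rule recursive_comp[OF assms(2)])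
      (intro recursive_npair recursive_nfst recursive_nsnd recursive_id)
  then have "recursive (\<lambda>n. rec_nat (g n) (\<lambda>i y. h n y) (k n))"
    using assms by (intro recursive_rec) simp_all
  moreover have "rec_nat (g n) (\<lambda>i y. h n y) j = (h n ^^ j) (g n)" for n j
    by (induction j) simp_all
  ultimately show ?thesis by simp
qed

text \<open>Both branches of a case distinction between total functions may be evaluated, so recursion on
the truth value suffices.\<close>

definition decidable :: "(nat \<Rightarrow> bool) \<Rightarrow> bool"
  where "decidable P \<longleftrightarrow> recursive (\<lambda>n. if P n then 1 else 0)"

lemma recursive_if:
  assumes "decidable P" "recursive s" "recursive t"
  shows "recursive (\<lambda>n. if P n then s n else t n)"
proof -
  have "recursive (\<lambda>m. s (nsnd (nsnd m)))"
    by (rule recursive_comp[OF assms(2)]) (intro recursive_nsnd recursive_id)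
  then have "recursive (\<lambda>n. rec_nat (t n) (\<lambda>i y. s n) (if P n then 1 else 0))"
    using assms unfolding decidable_def by (intro recursive_rec)
  then show ?thesis by (rule back_subst[of recursive]) auto
qed

lemma decidable_eq:
  assumes "recursive s" "recursive t"
  shows "decidable (\<lambda>n. s n = t n)"
proof -
  have "recursive (\<lambda>n. 1 - ((s n - t n) + (t n - s n)))"
    using assms by (intro recursive_diff recursive_const recursive_add)
  then show ?thesis
    unfolding decidable_def by (rule back_subst[of recursive]) auto
qed

lemmas recursive_intros = recursive_id recursive_const recursive_Suc recursive_npair recursive_nfst
  recursive_nsnd recursive_ncons recursive_nhd recursive_ntl recursive_if decidable_eq
  recursive_add recursive_diff

section \<open>A universal machine\<close>

definition nnth :: "nat \<Rightarrow> nat \<Rightarrow> nat"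
  where "nnth l i = nhd ((ntl ^^ i) l)"

lemma nnth_list_encode: "i < length xs \<Longrightarrow> nnth (list_encode xs) i = xs ! i"
proof (induction xs arbitrary: i)
  case (Cons x xs)
  then show ?case by (cases i) (simp_all add: nnth_def funpow_swap1 del: funpow.simps(2) add: funpow_Suc_right)
qed simp

lemma recursive_nnth: "recursive s \<Longrightarrow> recursive t \<Longrightarrow> recursive (\<lambda>n. nnth (s n) (t n))"
  unfolding nnth_def by (intro recursive_nhd recursive_funpow recursive_ntl recursive_nfst recursive_id)

text \<open>The universal function for \<^typ>\<open>recf\<close> is computed by a stack machine. A configuration is a pair of
a list of tasks and a stack of values. Evaluating a program means to replace the task
\<open>eval_task\<close> eventually by its value on top of the stack. The arguments of a composition
are evaluated from left to right; \<open>cons_task\<close> assembles their values to a list, to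
which \<open>call_task\<close> applies the outer program. The tasks \<open>rec_task\<close> and \<open>test_task\<close> wait for the
previous value of a primitive recursion and for the value tested by a minimisation.\<close>

abbreviation (input) eval_task :: "nat \<Rightarrow> nat \<Rightarrow> nat"
  where "eval_task f xs \<equiv> \<langle>0, \<langle>f, xs\<rangle>\<rangle>"
abbreviation (input) args_task :: "nat \<Rightarrow> nat \<Rightarrow> nat"
  where "args_task gs xs \<equiv> \<langle>1, \<langle>gs, xs\<rangle>\<rangle>"
abbreviation (input) cons_task :: "nat"
  where "cons_task \<equiv> \<langle>2, 0\<rangle>"
abbreviation (input) call_task :: "nat \<Rightarrow> nat"
  where "call_task f \<equiv> \<langle>3, f\<rangle>"
abbreviation (input) rec_task :: "nat \<Rightarrow> nat \<Rightarrow> nat \<Rightarrow> nat"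
  where "rec_task g n xs \<equiv> \<langle>4, \<langle>g, \<langle>n, xs\<rangle>\<rangle>\<rangle>"
abbreviation (input) search_task :: "nat \<Rightarrow> nat \<Rightarrow> nat \<Rightarrow> nat"
  where "search_task f xs i \<equiv> \<langle>5, \<langle>f, \<langle>xs, i\<rangle>\<rangle>\<rangle>"
abbreviation (input) test_task :: "nat \<Rightarrow> nat \<Rightarrow> nat \<Rightarrow> nat"
  where "test_task f xs i \<equiv> \<langle>6, \<langle>f, \<langle>xs, i\<rangle>\<rangle>\<rangle>"

definition eval_step :: "nat \<Rightarrow> nat \<Rightarrow> nat \<Rightarrow> nat \<Rightarrow> nat"
  where "eval_step f xs T V =
    (if nhd f = 0 then \<langle>T, ncons 0 V\<rangle>
     else if nhd f = 1 then \<langle>T, ncons (Suc (nhd xs)) V\<rangle>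
     else if nhd f = 2 then \<langle>T, ncons (nnth xs (nhd (ntl f))) V\<rangle>
     else if nhd f = 3 then
       \<langle>ncons (args_task (ntl (ntl f)) xs) (ncons (call_task (nhd (ntl f))) T), V\<rangle>
     else if nhd f = 4 then
       (if nhd xs = 0 then \<langle>ncons (eval_task (nhd (ntl f)) (ntl xs)) T, V\<rangle>
        else \<langle>ncons (eval_task f (ncons (nhd xs - 1) (ntl xs)))
               (ncons (rec_task (nhd (ntl (ntl f))) (nhd xs - 1) (ntl xs)) T), V\<rangle>)
     else \<langle>ncons (search_task (nhd (ntl f)) xs 0) T, V\<rangle>)"

definition task_step :: "nat \<Rightarrow> nat \<Rightarrow> nat \<Rightarrow> nat \<Rightarrow> nat"
  where "task_step k d T V =
    (if k = 0 then eval_step (nfst d) (nsnd d) T V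
     else if k = 1 then
       (if nfst d = 0 then \<langle>T, ncons 0 V\<rangle>
        else \<langle>ncons (eval_task (nhd (nfst d)) (nsnd d))
               (ncons (args_task (ntl (nfst d)) (nsnd d)) (ncons cons_task T)), V\<rangle>)
     else if k = 2 then \<langle>T, ncons (ncons (nhd (ntl V)) (nhd V)) (ntl (ntl V))\<rangle>
     else if k = 3 then \<langle>ncons (eval_task d (nhd V)) T, ntl V\<rangle>
     else if k = 4 then
       \<langle>ncons (eval_task (nfst d) (ncons (nfst (nsnd d)) (ncons (nhd V) (nsnd (nsnd d))))) T, ntl V\<rangle>
     else if k = 5 then
       \<langle>ncons (eval_task (nfst d) (ncons (nsnd (nsnd d)) (nfst (nsnd d)))) (ncons \<langle>6, d\<rangle> T), V\<rangle>
     else if nhd V = 0 then \<langle>T, ncons (nsnd (nsnd d)) (ntl V)\<rangle>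
     else \<langle>ncons (search_task (nfst d) (nfst (nsnd d)) (Suc (nsnd (nsnd d)))) T, ntl V\<rangle>)"

text \<open>Configurations without tasks are fixed points, so a result persists once it has been reached.\<close>

definition machine_step :: "nat \<Rightarrow> nat"
  where "machine_step c =
    (if nfst c = 0 then c
     else task_step (nfst (nhd (nfst c))) (nsnd (nhd (nfst c))) (ntl (nfst c)) (nsnd c))"

lemma recursive_machine_step: "recursive t \<Longrightarrow> recursive (\<lambda>n. machine_step (t n))"
proof (rule recursive_comp[of machine_step])
  have 0: "recursive (\<lambda>n. eval_step (f n) (xs n) (T n) (V n))"
    if "recursive f" "recursive xs" "recursive T" "recursive V" for f xs T V
    unfolding eval_step_def by (intro recursive_intros recursive_nnth that)
  have "recursive (\<lambda>n. task_step (k n) (d n) (T n) (V n))"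
    if "recursive k" "recursive d" "recursive T" "recursive V" for k d T V
    unfolding task_step_def by (intro recursive_intros 0 that)
  note 1 = this
  show "recursive machine_step"
    unfolding machine_step_def by (intro recursive_intros 1)
qed

definition reaches :: "nat \<Rightarrow> nat \<Rightarrow> bool"
  where "reaches c d \<longleftrightarrow> (\<exists>k. (machine_step ^^ k) c = d)"

lemma reaches_refl: "reaches c c"
  unfolding reaches_def by (rule exI[of _ 0]) simp

lemma reaches_trans [trans]: "reaches c d \<Longrightarrow> reaches d e \<Longrightarrow> reaches c e"
  unfolding reaches_def by (metis comp_apply funpow_add)

lemma reaches_step: "reaches (machine_step c) d \<Longrightarrow> reaches c d"
  unfolding reaches_def by (metis comp_apply funpow_Suc_right)

lemmas machine_simps = machine_step_def task_step_def eval_step_def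

text \<open>The remaining tasks and values are arbitrary: while a program is being evaluated, the machine does
not look below the part of its stacks that belongs to that program.\<close>

lemma reaches_eval:
  "computes f xs y \<Longrightarrow>
    reaches \<langle>ncons (eval_task (goedel f) (list_encode xs)) T, V\<rangle> \<langle>T, ncons y V\<rangle>"
proof (induction arbitrary: T V rule: computes.induct)
  case (Zero xs)
  show ?case by (rule reaches_step) (simp add: machine_simps reaches_refl)
next
  case (Succ x)
  show ?case by (rule reaches_step) (simp add: machine_simps reaches_refl)
next
  case (Proj i xs)
  show ?case
    by (rule reaches_step) (simp add: machine_simps reaches_refl nnth_list_encode[OF Proj])
next
  case (Comp xs gs ys f z)
  have args: "reaches \<langle>ncons (args_task (list_encode (map goedel gs)) (list_encode xs)) T, V\<rangle>
      \<langle>T, ncons (list_encode ys) V\<rangle>" for T V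
    using Comp.IH(1)
  proof (induction gs ys arbitrary: T V rule: list_all2_induct)
    case Nil
    show ?case by (rule reaches_step) (simp add: machine_simps reaches_refl)
  next
    case (Cons g gs y ys)
    have "reaches \<langle>ncons (eval_task (goedel g) (list_encode xs))
           (ncons (args_task (list_encode (map goedel gs)) (list_encode xs)) (ncons cons_task T)), V\<rangle>
        \<langle>ncons (args_task (list_encode (map goedel gs)) (list_encode xs)) (ncons cons_task T), ncons y V\<rangle>"
      using Cons.hyps(1) by blast
    also have "reaches \<dots> \<langle>ncons cons_task T, ncons (list_encode ys) (ncons y V)\<rangle>"
      by (rule Cons.IH)
    also have "reaches \<dots> \<langle>T, ncons (list_encode (y # ys)) V\<rangle>"
      by (rule reaches_step) (simp add: machine_simps reaches_refl)
    finally show ?case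
      by (intro reaches_step[of "\<langle>ncons _ _, _\<rangle>"]) (simp add: machine_simps)
  qed
  have "reaches \<langle>ncons (call_task (goedel f)) T, ncons (list_encode ys) V\<rangle> \<langle>T, ncons z V\<rangle>"
    using Comp.IH(2)[of T V] by (intro reaches_step[of "\<langle>ncons _ _, _\<rangle>"]) (simp add: machine_simps)
  with args[of "ncons (call_task (goedel f)) T" V] show ?case
    by (intro reaches_step[of "\<langle>ncons _ _, _\<rangle>"]) (simp add: machine_simps reaches_trans)
next
  case (PrimRec_0 f xs z g)
  from PrimRec_0.IH show ?case
    by (intro reaches_step[of "\<langle>ncons _ _, _\<rangle>"]) (simp add: machine_simps)
next
  case (PrimRec_Suc f g n xs y z)
  let ?T = "ncons (rec_task (goedel g) n (list_encode xs)) T"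
  have "reaches \<langle>ncons (eval_task (goedel (PrimRec f g)) (list_encode (n # xs))) ?T, V\<rangle>
      \<langle>?T, ncons y V\<rangle>"
    by (rule PrimRec_Suc.IH)
  also have "reaches \<dots> \<langle>T, ncons z V\<rangle>"
    using PrimRec_Suc.IH(2) by (intro reaches_step[of "\<langle>ncons _ _, _\<rangle>"]) (simp add: machine_simps)
  finally show ?case
    by (intro reaches_step[of "\<langle>ncons _ _, _\<rangle>"]) (simp add: machine_simps)
next
  case (Mu f n xs)
  let ?S = "\<lambda>i. \<langle>ncons (search_task (goedel f) (list_encode xs) i) T, V\<rangle>"
  have test: "reaches (?S i) \<langle>ncons (test_task (goedel f) (list_encode xs) i) T, ncons y V\<rangle>"
    if "\<forall>T V. reaches \<langle>ncons (eval_task (goedel f) (list_encode (i # xs))) T, V\<rangle> \<langle>T, ncons y V\<rangle>"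
    for i y
    using that by (intro reaches_step[of "\<langle>ncons _ _, _\<rangle>"]) (simp add: machine_simps)
  have "reaches (?S 0) (?S i)" if "i \<le> n" for i
    using that
  proof (induction i)
    case 0
    show ?case by (rule reaches_refl)
  next
    case (Suc i)
    then obtain y where "\<forall>T V. reaches \<langle>ncons (eval_task (goedel f) (list_encode (i # xs))) T, V\<rangle>
        \<langle>T, ncons (Suc y) V\<rangle>"
      using Mu.IH(2) by (metis Suc_le_lessD)
    note test[OF this]
    also have "reaches \<langle>ncons (test_task (goedel f) (list_encode xs) i) T, ncons (Suc y) V\<rangle>
        (?S (Suc i))"
      by (rule reaches_step) (simp add: machine_simps reaches_refl)
    finally show ?case using Suc reaches_trans by simp
  qed
  also have "reaches (?S n) \<langle>ncons (test_task (goedel f) (list_encode xs) n) T, ncons 0 V\<rangle>"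
    using Mu.IH(1) by (intro test) blast
  also have "reaches \<dots> \<langle>T, ncons n V\<rangle>"
    by (rule reaches_step) (simp add: machine_simps reaches_refl)
  finally show ?case
    by (intro reaches_step[of "\<langle>ncons (eval_task (goedel (Mu f)) _) _, _\<rangle>"]) (simp add: machine_simps)
qed

lemma machine_step_halted: "nfst c = 0 \<Longrightarrow> (machine_step ^^ k) c = c"
  by (induction k) (simp_all add: machine_step_def)

text \<open>Minimisation finds the first moment at which the machine has halted; its configuration then is
the one promised by \<open>reaches_eval\<close>.\<close>

theorem universal_program:
  "\<exists>U. \<forall>f n y. computes f [n] y \<longrightarrow> computes U [\<langle>goedel f, n\<rangle>] y"
proof -
  define run where
    "run w i = (machine_step ^^ i) \<langle>ncons (eval_task (nfst w) (ncons (nsnd w) 0)) 0, 0\<rangle>" for w i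
  have "recursive (\<lambda>m. nfst (run (nfst m) (nsnd m)))" "recursive (\<lambda>m. nhd (nsnd (run (nfst m) (nsnd m))))"
    unfolding run_def
    by (intro recursive_intros recursive_funpow recursive_machine_step)+
  then obtain P Q where P: "\<And>m. computes P [m] (nfst (run (nfst m) (nsnd m)))"
    and Q: "\<And>m. computes Q [m] (nhd (nsnd (run (nfst m) (nsnd m))))"
    unfolding recursive_def by blast
  obtain C where C: "\<And>m n. computes C [m, n] \<langle>m, n\<rangle>"
    using recursive2_npair unfolding recursive2_def by blast
  define R where "R = Comp P [Comp C [Proj 1, Proj 0]]"
  have R: "computes R [i, w] (nfst (run w i))" for i w
    using computes_Comp1[OF computes_Comp2[OF computes_Proj_1 computes_Proj_0 C] P, of i w "[]"]
    by (simp add: R_def)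
  have "computes (Comp Q [Comp C [Proj 0, Mu R]]) [\<langle>goedel f, n\<rangle>] y" if ev: "computes f [n] y" for f n y
  proof -
    let ?w = "\<langle>goedel f, n\<rangle>"
    obtain k where k: "run ?w k = \<langle>0, ncons y 0\<rangle>"
      using reaches_eval[OF ev] unfolding reaches_def run_def by auto
    define i where "i = (LEAST i. nfst (run ?w i) = 0)"
    have i: "nfst (run ?w i) = 0" and min: "\<And>j. j < i \<Longrightarrow> nfst (run ?w j) \<noteq> 0" and "i \<le> k"
      unfolding i_def using k LeastI[of "\<lambda>i. nfst (run ?w i) = 0" k] not_less_Least
      by (auto intro: Least_le)
    have "run ?w k = (machine_step ^^ (k - i)) (run ?w i)"
      using \<open>i \<le> k\<close> unfolding run_def by (metis comp_apply funpow_add le_add_diff_inverse2)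
    then have "run ?w i = \<langle>0, ncons y 0\<rangle>"
      using k machine_step_halted[OF i] by simp
    moreover have "computes (Mu R) [?w] i"
      using R[of i ?w] R[of _ ?w] i min by (intro computes.Mu) (auto simp: gr0_conv_Suc, metis not0_implies_Suc)
    ultimately show ?thesis
      using computes_Comp1[OF computes_Comp2[OF computes_Proj_0 _ C, of "Mu R" ?w "[]" i] Q] by simp
  qed
  then show ?thesis by blast
qed

section \<open>Effective partial applicative structures on the natural numbers\<close>

text \<open>The extra component \<open>i\<close> in the third assumption makes it possible to apply a computed index to a
computed argument: sequencing passes on the old argument together with the new value. The
composition with recursive functions is derived from this.\<close>

locale effective_pas =
  fixes X :: "nat pas"
  assumes program: "\<exists>e. \<forall>n y. computes P [n] y \<longrightarrow> X e n = Some y"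
    and sequence: "\<exists>c. \<forall>n y z. X b n = Some y \<longrightarrow> X a \<langle>n, y\<rangle> = Some z \<longrightarrow> X c n = Some z"
    and universal: "\<exists>u. \<forall>i a n y. X a n = Some y \<longrightarrow> X u \<langle>i, \<langle>a, n\<rangle>\<rangle> = Some y"
    and smn: "\<exists>s. recursive s \<and> (\<forall>a m n y. X a \<langle>m, n\<rangle> = Some y \<longrightarrow> X (s \<langle>a, m\<rangle>) n = Some y)"
begin

text \<open>A representing element may be defined on more arguments than the function that it represents.\<close>

definition programmable :: "(nat \<Rightarrow> nat option) \<Rightarrow> bool"
  where "programmable \<phi> \<longleftrightarrow> (\<exists>e. \<forall>n y. \<phi> n = Some y \<longrightarrow> X e n = Some y)"

lemma programmable_total: "recursive t \<Longrightarrow> programmable (\<lambda>n. Some (t n))"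
  using program unfolding recursive_def programmable_def by (metis option.inject)

lemma programmable_bind:
  assumes "programmable \<phi>" "programmable (\<lambda>m. \<psi> (nfst m) (nsnd m))"
  shows "programmable (\<lambda>n. Option.bind (\<phi> n) (\<psi> n))"
proof -
  obtain b a where b: "\<And>n y. \<phi> n = Some y \<Longrightarrow> X b n = Some y"
    and a: "\<And>m z. \<psi> (nfst m) (nsnd m) = Some z \<Longrightarrow> X a m = Some z"
    using assms unfolding programmable_def by blast
  obtain c where c: "\<And>n y z. X b n = Some y \<Longrightarrow> X a \<langle>n, y\<rangle> = Some z \<Longrightarrow> X c n = Some z"
    using sequence by blast
  have "X c n = Some z" if "Option.bind (\<phi> n) (\<psi> n) = Some z" for n z
    using that a[of "\<langle>n, _\<rangle>"] by (auto simp: bind_eq_Some_conv intro!: c b)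
  then show ?thesis unfolding programmable_def by blast
qed

lemma programmable_app:
  assumes "recursive a" "recursive t"
  shows "programmable (\<lambda>n. X (a n) (t n))"
proof -
  obtain u where u: "\<And>i a n y. X a n = Some y \<Longrightarrow> X u \<langle>i, \<langle>a, n\<rangle>\<rangle> = Some y"
    using universal by blast
  have "programmable (\<lambda>m. X (nfst (nsnd m)) (nsnd (nsnd m)))"
    unfolding programmable_def
    by (rule exI[of _ u]) (metis u npair_def nfst_def nsnd_def prod.collapse prod_decode_inverse)
  then have "programmable (\<lambda>n. Option.bind (Some \<langle>a n, t n\<rangle>) (\<lambda>m. X (nfst m) (nsnd m)))"
    using assms by (intro programmable_bind programmable_total recursive_npair)
  then show ?thesis by simp
qed

lemma programmable_comp:
  assumes "programmable \<phi>" "recursive t"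
  shows "programmable (\<lambda>n. \<phi> (t n))"
proof -
  obtain e where "\<And>n y. \<phi> n = Some y \<Longrightarrow> X e n = Some y"
    using assms(1) unfolding programmable_def by blast
  moreover have "programmable (\<lambda>n. X e (t n))"
    by (intro programmable_app recursive_const assms)
  ultimately show ?thesis unfolding programmable_def by meson
qed

text \<open>A case distinction selects an index first and applies it afterwards, so that the branch that
  is not taken may be undefined.\<close>

lemma programmable_if:
  assumes "decidable P" "programmable \<phi>" "programmable \<psi>"
  shows "programmable (\<lambda>n. if P n then \<phi> n else \<psi> n)"
proof -
  obtain a b where "\<And>n y. \<phi> n = Some y \<Longrightarrow> X a n = Some y" "\<And>n y. \<psi> n = Some y \<Longrightarrow> X b n = Some y"
    using assms(2,3) unfolding programmable_def by blast
  moreover have "programmable (\<lambda>n. X (if P n then a else b) n)"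
    by (intro programmable_app recursive_if recursive_const recursive_id assms(1))
  ultimately show ?thesis unfolding programmable_def by (smt (verit))
qed

definition curry_index :: "nat \<Rightarrow> nat \<Rightarrow> nat"
  where "curry_index a m = (SOME s. recursive s \<and>
    (\<forall>a m n y. X a \<langle>m, n\<rangle> = Some y \<longrightarrow> X (s \<langle>a, m\<rangle>) n = Some y)) \<langle>a, m\<rangle>"

lemma recursive_curry_index:
    "recursive a \<Longrightarrow> recursive m \<Longrightarrow> recursive (\<lambda>n. curry_index (a n) (m n))"
  unfolding curry_index_def
  using someI_ex[OF smn] by (auto intro: recursive_comp recursive_npair)

lemma app_curry_index: "X a \<langle>m, n\<rangle> = Some y \<Longrightarrow> X (curry_index a m) n = Some y"
  unfolding curry_index_def using someI_ex[OF smn] by blast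

text \<open>Kleene's second recursion theorem, with the usual proof: the index is obtained by applying the
s-m-n function to a program \<open>d\<close> for \<open>\<lambda>\<langle>x, n\<rangle>. \<Phi> (s \<langle>x, x\<rangle>) n\<close> and \<open>d\<close> itself.\<close>

theorem recursion:
  assumes "programmable (\<lambda>m. \<Phi> (nfst m) (nsnd m))"
  obtains r where "\<And>n y. \<Phi> r n = Some y \<Longrightarrow> X r n = Some y"
proof -
  have "programmable (\<lambda>m. \<Phi> (nfst \<langle>curry_index (nfst m) (nfst m), nsnd m\<rangle>)
      (nsnd \<langle>curry_index (nfst m) (nfst m), nsnd m\<rangle>))"
    by (rule programmable_comp[OF assms]) (intro recursive_intros recursive_curry_index)
  then obtain d where
    "\<And>m y. \<Phi> (curry_index (nfst m) (nfst m)) (nsnd m) = Some y \<Longrightarrow> X d m = Some y"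
    unfolding programmable_def by auto
  from this[of "\<langle>d, _\<rangle>"] show thesis
    by (intro that[of "curry_index d d"] app_curry_index) simp
qed

text \<open>Currying: the two arguments may be supplied one after the other, as is required of \<open>k\<close>, \<open>s\<close> and
the realizers of applicative morphisms.\<close>

lemma represent:
  assumes "programmable (\<lambda>m. \<phi> (nfst m) (nsnd m))"
  obtains r where "\<And>m n y. \<phi> m n = Some y \<Longrightarrow> Option.bind (X r m) (\<lambda>s. X s n) = Some y"
proof -
  obtain e where e: "\<And>m n y. \<phi> m n = Some y \<Longrightarrow> X e \<langle>m, n\<rangle> = Some y"
    using assms unfolding programmable_def by (metis nfst_npair nsnd_npair)
  obtain r where "\<And>m. X r m = Some (curry_index e m)"
    using programmable_total[of "curry_index e"] recursive_curry_index[OF recursive_const recursive_id]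
    unfolding programmable_def by blast
  then show thesis by (intro that[of r]) (simp_all add: e app_curry_index)
qed

theorem pca: "pca X"
proof -
  obtain k where k: "\<And>m n. Option.bind (X k m) (\<lambda>s. X s n) = Some m"
    using represent[of "\<lambda>m n. Some m"] programmable_total[OF recursive_nfst[OF recursive_id]] by metis
  have "programmable (\<lambda>m. Option.bind (X (nfst (nfst m)) (nsnd m)) (\<lambda>u.
      Option.bind (X (nsnd (nfst m)) (nsnd m)) (X u)))"
    by (intro programmable_bind programmable_app recursive_intros)
  then obtain e where e: "\<And>a b c y. Option.bind (X a c) (\<lambda>u. Option.bind (X b c) (X u)) = Some y
      \<Longrightarrow> X e \<langle>\<langle>a, b\<rangle>, c\<rangle> = Some y"
    unfolding programmable_def by (metis nfst_npair nsnd_npair)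
  define \<phi> where "\<phi> a b = Some (curry_index e \<langle>a, b\<rangle>)" for a b
  have "programmable (\<lambda>m. \<phi> (nfst m) (nsnd m))"
    unfolding \<phi>_def by (intro programmable_total recursive_curry_index recursive_intros)
  then obtain s where "\<And>a b y. \<phi> a b = Some y \<Longrightarrow> Option.bind (X s a) (\<lambda>t. X t b) = Some y"
    by (rule represent) blast
  then have s: "Option.bind (X s a) (\<lambda>t. X t b) = Some (curry_index e \<langle>a, b\<rangle>)" for a b
    unfolding \<phi>_def by blast
  have "Some s \<cdot>\<^bsub>X\<^esub> Some a \<cdot>\<^bsub>X\<^esub> Some b = Some (curry_index e \<langle>a, b\<rangle>)" for a b
    using s[of a b] unfolding papp_def by simp
  moreover have "Some (curry_index e \<langle>a, b\<rangle>) \<cdot>\<^bsub>X\<^esub> Some c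
      \<lesssim> (Some a \<cdot>\<^bsub>X\<^esub> Some c) \<cdot>\<^bsub>X\<^esub> (Some b \<cdot>\<^bsub>X\<^esub> Some c)" for a b c
    unfolding plesssim_def papp_def
    using app_curry_index[OF e, of a c b] by fastforce
  moreover have "Some k \<cdot>\<^bsub>X\<^esub> Some a \<cdot>\<^bsub>X\<^esub> Some b = Some a" for a b
    using k[of a b] unfolding papp_def by simp
  ultimately show ?thesis unfolding pca_def by (metis option.distinct(1))
qed

lemma applicative_morphism_Id:
  assumes "programmable (\<lambda>m. A (nfst m) (nsnd m))"
  shows "applicative_morphism A X Id"
proof -
  obtain r where "\<And>m n y. A m n = Some y \<Longrightarrow> Option.bind (X r m) (\<lambda>s. X s n) = Some y"
    using represent[OF assms] by metis
  then show ?thesis unfolding applicative_morphism_def papp_def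
    by (auto intro!: exI[of _ r])
qed

end

locale effective_pas_with_oracle = effective_pas X for X +
  fixes F :: "(nat \<Rightarrow> nat) \<Rightarrow> nat"
  assumes functional: "\<exists>q. \<forall>h g. (\<forall>k. X h k = Some (g k)) \<longrightarrow> X q h = Some (F g)"

section \<open>Kleene's first model\<close>

lemma K1_goedel: "K1 (goedel f) n = Some y \<longleftrightarrow> computes f [n] y"
  unfolding K1_def phi_def
  by (subst graph_val_eq_Some_iff) (auto dest: goedel_inject intro: computes_functional)

lemma K1_eq_Some: "K1 e n = Some y \<longleftrightarrow> (\<exists>f. e = goedel f \<and> computes f [n] y)"
  unfolding K1_def phi_def
  by (subst graph_val_eq_Some_iff) (auto dest: goedel_inject intro: computes_functional)

text \<open>The s-m-n function of \<open>K\<^sub>1\<close> inserts a constant as first component of the argument. For this the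
Goedel number of a constant must depend recursively on its value.\<close>

primrec constant_program :: "nat \<Rightarrow> recf" where
  "constant_program 0 = Zero"
| "constant_program (Suc m) = Comp Succ [constant_program m]"

lemma computes_constant_program: "computes (constant_program m) xs m"
  by (induction m) (auto intro: computes.Zero computes_Comp1 computes_Succ)

lemma recursive_goedel_constant_program: "recursive t \<Longrightarrow> recursive (\<lambda>n. goedel (constant_program (t n)))"
proof (rule recursive_comp[of "\<lambda>n. goedel (constant_program n)"])
  have "recursive (\<lambda>n. rec_nat (goedel Zero) (\<lambda>i y. list_encode [3, goedel Succ, y]) n)"
    unfolding list_encode_ncons by (intro recursive_intros recursive_rec)
  moreover have "rec_nat (goedel Zero) (\<lambda>i y. list_encode [3, goedel Succ, y]) n
      = goedel (constant_program n)" for n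
    by (induction n) simp_all
  ultimately show "recursive (\<lambda>n. goedel (constant_program n))"
    by (auto elim!: back_subst[of recursive])
qed

interpretation K1: effective_pas K1
proof
  obtain C where C: "\<And>m n. computes C [m, n] \<langle>m, n\<rangle>"
    using recursive2_npair unfolding recursive2_def by blast
  fix P a b
  show "\<exists>e. \<forall>n y. computes P [n] y \<longrightarrow> K1 e n = Some y"
    using K1_goedel by blast
  show "\<exists>c. \<forall>n y z. K1 b n = Some y \<longrightarrow> K1 a \<langle>n, y\<rangle> = Some z \<longrightarrow> K1 c n = Some z"
  proof (cases "\<exists>f g. a = goedel f \<and> b = goedel g")
    case True
    then obtain f g where fg: "a = goedel f" "b = goedel g" by blast
    have "computes (Comp f [Comp C [Proj 0, g]]) [n] z" if "computes g [n] y" "computes f [\<langle>n, y\<rangle>] z" for n y z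
      by (rule computes_Comp1[OF computes_Comp2[OF computes_Proj_0 that(1) C] that(2)])
    then show ?thesis unfolding fg K1_goedel
      by (intro exI[of _ "goedel (Comp f [Comp C [Proj 0, g]])"]) (simp only: K1_goedel, blast)
  qed (auto simp: K1_eq_Some)
  obtain U where U: "\<And>f n y. computes f [n] y \<Longrightarrow> computes U [\<langle>goedel f, n\<rangle>] y"
    using universal_program by blast
  obtain Q where Q: "\<And>n. computes Q [n] (nsnd n)"
    using recursive_nsnd[OF recursive_id] unfolding recursive_def by blast
  have "computes (Comp U [Q]) [\<langle>i, \<langle>goedel f, n\<rangle>\<rangle>] y" if "computes f [n] y" for i f n y
    using Q[of "\<langle>i, \<langle>goedel f, n\<rangle>\<rangle>"] U[OF that] computes_Comp1 by simp
  then have "K1 (goedel (Comp U [Q])) \<langle>i, \<langle>e, n\<rangle>\<rangle> = Some y" if "K1 e n = Some y" for i e n y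
    using that by (auto simp only: K1_goedel K1_eq_Some[of e])
  then show "\<exists>u. \<forall>i a n y. K1 a n = Some y \<longrightarrow> K1 u \<langle>i, \<langle>a, n\<rangle>\<rangle> = Some y" by blast
  define s where "s w = list_encode [3, nfst w,
    list_encode [3, goedel C, goedel (constant_program (nsnd w)), goedel (Proj 0)]]" for w
  have "recursive s"
    unfolding s_def list_encode_ncons by (intro recursive_intros recursive_goedel_constant_program)
  moreover have "K1 (s \<langle>e, m\<rangle>) n = Some y" if "K1 e \<langle>m, n\<rangle> = Some y" for e m n y
  proof -
    obtain f where f: "e = goedel f" "computes f [\<langle>m, n\<rangle>] y" using \<open>K1 e \<langle>m, n\<rangle> = Some y\<close> K1_eq_Some by blast
    have s: "s \<langle>e, m\<rangle> = goedel (Comp f [Comp C [constant_program m, Proj 0]])"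
      by (simp add: s_def f)
    show ?thesis
      unfolding s K1_goedel
      by (rule computes_Comp1[OF computes_Comp2[OF computes_constant_program computes_Proj_0 C] f(2)])
  qed
  ultimately show "\<exists>s. recursive s \<and> (\<forall>a m n y. K1 a \<langle>m, n\<rangle> = Some y \<longrightarrow> K1 (s \<langle>a, m\<rangle>) n = Some y)"
    by blast
qed

text \<open>This makes \<open>K\<^sub>1\<close> the least effective structure. Through it, programs for \<open>K\<^sub>1\<close>, among
them those that operate on the given tuple coding, are available everywhere.\<close>

lemma (in effective_pas) programmable_K1:
  assumes "K1.programmable \<phi>"
  shows "programmable \<phi>"
proof (cases "\<exists>n y. \<phi> n = Some y")
  case True
  then obtain f where f: "\<And>n y. \<phi> n = Some y \<Longrightarrow> computes f [n] y"
    using assms unfolding K1.programmable_def K1_eq_Some by (metis goedel_inject)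
  then show ?thesis using program[of f] unfolding programmable_def by blast
qed (auto simp: programmable_def)

section \<open>Kleene's schemes\<close>

context
  notes list_encode_ncons [simp del]
begin

abbreviation (input) succ_index :: nat
  where "succ_index \<equiv> list_encode [1, 1]"

text \<open>A function of arity \<open>r\<close> is represented by an index of arity \<open>r + 1\<close> whose first argument is meant
to be the index of the successor function. The constructions below show that this additional
argument turns the schemes into a calculus with constants, composition, unrestricted choice of
arguments and general recursion. They provide explicit indices that depend on arities only, not
on arguments.\<close>

definition equipped :: "((nat \<Rightarrow> nat) \<Rightarrow> nat) \<Rightarrow> nat \<Rightarrow> nat list \<Rightarrow> nat \<Rightarrow> bool"
  where "equipped F e xs y \<longleftrightarrow> kleene F e (succ_index # xs) y"

lemma kleene_move_1:
  "kleene F g (b # a # xs) z \<Longrightarrow> r = length xs + 2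
    \<Longrightarrow> kleene F (list_encode [6, r, 1, g]) (a # b # xs) z"
  using S6[of "a # b # xs" r 1 F g z] by simp

lemma kleene_move_2:
  "kleene F g (c # a # b # xs) z \<Longrightarrow> r = length xs + 3
    \<Longrightarrow> kleene F (list_encode [6, r, 2, g]) (a # b # c # xs) z"
  using S6[of "a # b # c # xs" r 2 F g z] by simp

lemma kleene_move_3:
  "kleene F g (d # a # b # c # xs) z \<Longrightarrow> r = length xs + 4
    \<Longrightarrow> kleene F (list_encode [6, r, 3, g]) (a # b # c # d # xs) z"
  using S6[of "a # b # c # d # xs" r 3 F g z] by (simp add: numeral_3_eq_3)

lemma kleene_apply:
  "kleene F e ys z \<Longrightarrow> ns = ys @ xs \<Longrightarrow> k = length ys \<Longrightarrow> l = length xs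
    \<Longrightarrow> kleene F (list_encode [9, k, l]) (e # ns) z"
  using S9[of "ys @ xs" "length ys" "length xs" F e z] by simp

text \<open>The basic mode of composition computes a value and adds it to the arguments. S4 puts it in front of
the index of the successor function, whose place S6 restores.\<close>

definition push_index :: "nat \<Rightarrow> nat \<Rightarrow> nat \<Rightarrow> nat"
  where "push_index r h g = list_encode [4, r + 1, list_encode [6, r + 2, 1, g], h]"

lemma equipped_push:
  assumes "equipped F h xs y" "equipped F g (y # xs) z" "length xs = r"
  shows "equipped F (push_index r h g) xs z"
  using assms unfolding equipped_def push_index_def
  by (intro S4 kleene_move_1) auto

definition proj_index :: "nat \<Rightarrow> nat \<Rightarrow> nat"
  where "proj_index r i = list_encode [6, r + 1, i + 1, list_encode [3, r + 1]]"

lemma equipped_proj: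
  assumes "i < length xs" "length xs = r"
  shows "equipped F (proj_index r i) xs (xs ! i)"
proof -
  let ?ns = "xs ! i # take (i + 1) (succ_index # xs) @ drop (i + 1 + 1) (succ_index # xs)"
  have "kleene F (list_encode [3, r + 1]) ?ns (?ns ! 0)"
    using assms by (intro S3) auto
  then show ?thesis
    using assms unfolding equipped_def proj_index_def by (intro S6) auto
qed

text \<open>The index of the successor function is the only constant at hand. Applying it repeatedly
to itself yields all larger numbers.\<close>

primrec shift_index :: "nat \<Rightarrow> nat \<Rightarrow> nat" where
  "shift_index r 0 = list_encode [3, r + 1]"
| "shift_index r (Suc j) = push_index r (shift_index r j) (list_encode [9, 1, r])"

lemma equipped_shift: "length xs = r \<Longrightarrow> equipped F (shift_index r j) xs (succ_index + j)"
proof (induction j)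
  case 0
  then show ?case
    using S3[of "succ_index # xs" "r + 1" F] by (simp add: equipped_def)
next
  case (Suc j)
  have "equipped F (list_encode [9, 1, r]) ((succ_index + j) # xs) (succ_index + Suc j)"
    using kleene_apply[OF S1[of F "succ_index + j"], of _ xs] Suc.prems
    unfolding equipped_def by simp
  with Suc show ?case by (auto intro: equipped_push)
qed

text \<open>The index of the unary constant function with value \<open>c\<close> is larger than the index of the
successor function, hence available. Applying it to an arbitrary argument yields \<open>c\<close>.\<close>

definition const_index :: "nat \<Rightarrow> nat \<Rightarrow> nat"
  where "const_index r c = push_index r (shift_index r (list_encode [2, 1, c] - succ_index))
    (list_encode [6, r + 2, 1, list_encode [9, 1, r]])"

lemma equipped_const:
  assumes "length xs = r"
  shows "equipped F (const_index r c) xs c"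
proof -
  have "mono triangle" by (simp add: mono_iff_le_Suc)
  then have mono: "ncons a b \<le> ncons c d" if "a \<le> c" "b \<le> d" for a b c d
    using that unfolding ncons_def npair_eq by (simp add: add_mono monoD)
  have "succ_index \<le> list_encode [2, 1, c]"
    unfolding list_encode_ncons by (intro mono) simp_all
  then have "equipped F (shift_index r (list_encode [2, 1, c] - succ_index)) xs (list_encode [2, 1, c])"
    using equipped_shift[OF assms, of F "list_encode [2, 1, c] - succ_index"] by simp
  moreover have "equipped F (list_encode [6, r + 2, 1, list_encode [9, 1, r]])
      (list_encode [2, 1, c] # xs) c"
    unfolding equipped_def
    by (intro kleene_move_1 kleene_apply[OF S2, of _ _ xs]) (use assms in auto)
  ultimately show ?thesis
    unfolding const_index_def using assms by (rule equipped_push)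
qed

text \<open>Two ways of applying the first argument to those following it: as an index that expects the index
of the successor function, and, below, as an ordinary index of arity one or two.\<close>

definition call_first_index :: "nat \<Rightarrow> nat \<Rightarrow> nat"
  where "call_first_index m l = list_encode [6, m + l + 2, 1, list_encode [9, m + 1, l]]"

lemma equipped_call_first:
  "equipped F e ys z \<Longrightarrow> length ys = m \<Longrightarrow> length xs = l
    \<Longrightarrow> equipped F (call_first_index m l) (e # ys @ xs) z"
  unfolding equipped_def call_first_index_def
  by (intro kleene_move_1 kleene_apply[of F e "succ_index # ys" z _ xs]) auto

definition apply_first_index :: "nat \<Rightarrow> nat"
  where "apply_first_index l =
    list_encode [6, l + 3, 2, list_encode [6, l + 3, 2, list_encode [9, 1, l + 1]]]"

lemma equipped_apply_first:
  assumes "kleene F e [y] z" "length xs = l"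
  shows "equipped F (apply_first_index l) (e # y # xs) z"
  unfolding equipped_def apply_first_index_def
  by (intro kleene_move_2 kleene_apply[OF assms(1), of _ "succ_index # xs"]) (use assms(2) in auto)

definition apply2_first_index :: "nat \<Rightarrow> nat"
  where "apply2_first_index l = list_encode [6, l + 4, 3, list_encode [6, l + 4, 3,
    list_encode [6, l + 4, 3, list_encode [9, 2, l + 1]]]]"

lemma equipped_apply2_first:
  assumes "kleene F e [y1, y2] z" "length xs = l"
  shows "equipped F (apply2_first_index l) (e # y1 # y2 # xs) z"
  unfolding equipped_def apply2_first_index_def
  by (intro kleene_move_3 kleene_apply[OF assms(1), of _ "succ_index # xs"]) (use assms(2) in auto)

definition call_index :: "nat \<Rightarrow> nat \<Rightarrow> nat \<Rightarrow> nat"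
  where "call_index m l e = push_index (m + l) (const_index (m + l) e) (call_first_index m l)"

lemma equipped_call:
  assumes "equipped F e ys z" "length ys = m" "length xs = l"
  shows "equipped F (call_index m l e) (ys @ xs) z"
  unfolding call_index_def
  by (intro equipped_push[of F _ _ e] equipped_const equipped_call_first) (use assms in auto)

text \<open>Copies of the selected arguments are pushed in front of the given ones. Together with
\<open>call_index\<close> this allows to permute, duplicate and drop arguments.\<close>

primrec select_index :: "nat \<Rightarrow> nat list \<Rightarrow> nat \<Rightarrow> nat" where
  "select_index n [] g = g"
| "select_index n (i # I) g =
    select_index n I (push_index (length I + n) (proj_index (length I + n) (length I + i)) g)"

lemma equipped_select:
  "equipped F g (map ((!) xs) I @ xs) z \<Longrightarrow> length xs = n \<Longrightarrow> \<forall>i\<in>set I. i < n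
    \<Longrightarrow> equipped F (select_index n I g) xs z"
proof (induction I arbitrary: g)
  case (Cons i I)
  have "equipped F (proj_index (length I + n) (length I + i)) (map ((!) xs) I @ xs) (xs ! i)"
    using equipped_proj[of "length I + i" "map ((!) xs) I @ xs" "length I + n" F] Cons.prems
    by (simp add: nth_append)
  then have "equipped F (push_index (length I + n) (proj_index (length I + n) (length I + i)) g)
      (map ((!) xs) I @ xs) z"
    using Cons.prems by (intro equipped_push) auto
  with Cons show ?case by simp
qed simp

definition drop_index :: "nat \<Rightarrow> nat \<Rightarrow> nat \<Rightarrow> nat"
  where "drop_index j r e = select_index (j + r) [j..<j + r] (call_index r (j + r) e)"

lemma map_nth_append:
  "length zs = k \<Longrightarrow> m = k + length xs \<Longrightarrow> map ((!) (zs @ xs)) [k..<m] = xs"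
  by (rule nth_equalityI) auto

lemma equipped_drop:
  assumes "equipped F e xs z" "length zs = j" "length xs = r"
  shows "equipped F (drop_index j r e) (zs @ xs) z"
  unfolding drop_index_def
  by (intro equipped_select) (use assms map_nth_append[of zs j "j + r" xs] equipped_call[OF assms(1)] in auto)

text \<open>The values are computed from the last to the first, and each of the computations ignores those
already present.\<close>

primrec args_index :: "nat \<Rightarrow> nat list \<Rightarrow> nat \<Rightarrow> nat" where
  "args_index r [] g = g"
| "args_index r (e # es) g =
    args_index r es (push_index (length es + r) (drop_index (length es) r e) g)"

lemma equipped_args:
  "list_all2 (\<lambda>e. equipped F e xs) es ys \<Longrightarrow> equipped F g (ys @ xs) z \<Longrightarrow> length xs = r
    \<Longrightarrow> equipped F (args_index r es g) xs z"
proof (induction es ys arbitrary: g rule: list_all2_induct)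
  case (Cons e es y ys)
  then have "length ys = length es" by (simp add: list_all2_lengthD)
  then have "equipped F (push_index (length es + r) (drop_index (length es) r e) g) (ys @ xs) z"
    using Cons.prems Cons.hyps(1)
    by (intro equipped_push[of F _ _ y] equipped_drop) simp_all
  with Cons show ?case by simp
qed simp

definition apply_index :: "nat \<Rightarrow> nat \<Rightarrow> nat \<Rightarrow> nat"
  where "apply_index r e i = args_index r [const_index r e, proj_index r i] (apply_first_index r)"

lemma equipped_apply:
  "kleene F e [xs ! i] z \<Longrightarrow> i < length xs \<Longrightarrow> length xs = r \<Longrightarrow> equipped F (apply_index r e i) xs z"
  unfolding apply_index_def
  by (rule equipped_args[where ys = "[e, xs ! i]"])
    (auto intro: equipped_const equipped_proj equipped_apply_first)

definition apply2_index :: "nat \<Rightarrow> nat \<Rightarrow> nat \<Rightarrow> nat \<Rightarrow> nat"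
  where "apply2_index r e i c =
    args_index r [const_index r e, proj_index r i, const_index r c] (apply2_first_index r)"

lemma equipped_apply2:
  "kleene F e [xs ! i, c] z \<Longrightarrow> i < length xs \<Longrightarrow> length xs = r
    \<Longrightarrow> equipped F (apply2_index r e i c) xs z"
  unfolding apply2_index_def
  by (rule equipped_args[where ys = "[e, xs ! i, c]"])
    (auto intro: equipped_const equipped_proj equipped_apply2_first)

definition pred_index :: "nat \<Rightarrow> nat \<Rightarrow> nat"
  where "pred_index r i =
    apply2_index r (list_encode [5, 2, list_encode [2, 1, 0], list_encode [3, 3]]) i 0"

lemma equipped_pred:
  assumes "xs ! i = Suc n" "i < length xs" "length xs = r"
  shows "equipped F (pred_index r i) xs n"
proof -
  let ?e = "list_encode [5, 2, list_encode [2, 1, 0], list_encode [3, 3]]"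
  have "\<exists>y. kleene F ?e [n, 0] y" for n
  proof (induction n)
    case 0
    show ?case using S5_0[OF S2] by blast
  next
    case (Suc n)
    then obtain y where "kleene F ?e [n, 0] y" by blast
    from S5_Suc[OF this S3[of _ 3]] show ?case by auto
  qed
  then obtain y where "kleene F ?e [n, 0] y" by blast
  from S5_Suc[OF this S3[of _ 3]] have "kleene F ?e [Suc n, 0] n" by simp
  with assms show ?thesis unfolding pred_index_def by (intro equipped_apply2) auto
qed

text \<open>A case distinction chooses between two indices, by a primitive recursion S5 of which only the
question matters whether its argument is zero. As the step function of S5 cannot contain the
constant \<open>b\<close>, an index of a constant function is passed as parameter of the recursion.\<close>

definition case_index :: "nat \<Rightarrow> nat \<Rightarrow> nat \<Rightarrow> nat \<Rightarrow> nat"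
  where "case_index r i a b = apply2_index r
    (list_encode [5, 2, list_encode [2, 1, a], list_encode [6, 3, 2, list_encode [9, 1, 1]]]) i
    (list_encode [2, 1, b])"

lemma equipped_case:
  assumes "i < length xs" "length xs = r"
  shows "equipped F (case_index r i a b) xs (if xs ! i = 0 then a else b)"
proof -
  let ?c = "list_encode [2, 1, b]"
  let ?h = "list_encode [6, 3, 2, list_encode [9, 1, 1]]"
  let ?e = "list_encode [5, 2, list_encode [2, 1, a], ?h]"
  have h: "kleene F ?h [k, y, ?c] b" for k y
    by (intro kleene_move_2 kleene_apply[OF S2, of _ _ "[y]"]) auto
  have "kleene F ?e [k, ?c] (if k = 0 then a else b)" for k
  proof (induction k)
    case 0
    show ?case using S5_0[OF S2] by simp
  next
    case (Suc k)
    from S5_Suc[OF this h] show ?case by simp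
  qed
  with assms show ?thesis unfolding case_index_def by (intro equipped_apply2) auto
qed

text \<open>The recursion is organised by an index \<open>loop\<close> that receives itself as first argument. It selects
one of the two bodies by a case distinction and applies it to all arguments; the body for
successors then calls its first argument. Thus no fixed point has to be computed, and the
bodies do not depend on \<open>loop\<close>.\<close>

lemma equipped_PrimRec:
  assumes f: "\<And>xs y. length xs = r \<Longrightarrow> computes f xs y \<Longrightarrow> equipped F a xs y"
    and g: "\<And>xs y. length xs = r + 2 \<Longrightarrow> computes g xs y \<Longrightarrow> equipped F b xs y"
  obtains e where "\<And>n xs y. length xs = r \<Longrightarrow> computes (PrimRec f g) (n # xs) y \<Longrightarrow> equipped F e (n # xs) y"
proof -
  define i0 where "i0 = drop_index 2 r a"
  \<comment> \<open>The arguments \<open>loop, Suc n, xs\<close> are extended first by \<open>n\<close> and then by the previous value.\<close>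
  define i1 where "i1 = push_index (r + 2) (pred_index (r + 2) 1)
    (push_index (r + 3) (select_index (r + 3) ([1, 1, 0] @ [3..<3 + r]) (call_first_index (r + 2) (r + 3)))
      (select_index (r + 4) ([1, 0] @ [4..<4 + r]) (call_index (r + 2) (r + 4) b)))"
  define loop where "loop = push_index (r + 2) (case_index (r + 2) 1 i0 i1) (call_first_index (r + 2) 0)"
  have loop: "equipped F loop (loop # n # xs) y"
    if "computes (PrimRec f g) (n # xs) y" "length xs = r" for n xs y
    using that
  proof (induction n arbitrary: y)
    case 0
    then have "computes f xs y" by (auto elim: computes_cases)
    then have "equipped F i0 (loop # 0 # xs) y"
      using equipped_drop[OF f, of xs y "[loop, 0]" 2] 0 by (simp add: i0_def)
    then have "equipped F (call_first_index (r + 2) 0) (i0 # loop # 0 # xs) y"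
      using equipped_call_first[of F i0 "loop # 0 # xs" y "r + 2" "[]" 0] 0 by simp
    moreover have "equipped F (case_index (r + 2) 1 i0 i1) (loop # 0 # xs) i0"
      using equipped_case[of 1 "loop # 0 # xs" "r + 2" F i0 i1] 0 by simp
    ultimately show ?case
      using 0 by (subst loop_def) (auto intro: equipped_push)
  next
    case (Suc n)
    then obtain x where x: "computes (PrimRec f g) (n # xs) x" "computes g (n # x # xs) y"
      by (auto elim: computes_cases)
    have "equipped F loop (loop # n # xs) x" using x(1) Suc by blast
    then have "equipped F (call_first_index (r + 2) (r + 3))
        (loop # (loop # n # xs) @ (n # loop # Suc n # xs)) x"
      using Suc.prems by (intro equipped_call_first) auto
    moreover have "map ((!) (n # loop # Suc n # xs)) [3..<3 + r] = xs"
      using map_nth_append[of "[n, loop, Suc n]" 3 "3 + r" xs] Suc.prems by simp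
    ultimately have 1: "equipped F
        (select_index (r + 3) ([1, 1, 0] @ [3..<3 + r]) (call_first_index (r + 2) (r + 3)))
        (n # loop # Suc n # xs) x"
      using Suc.prems by (intro equipped_select) auto
    have "equipped F b (n # x # xs) y" using g x(2) Suc.prems by simp
    then have "equipped F (call_index (r + 2) (r + 4) b) ((n # x # xs) @ (x # n # loop # Suc n # xs)) y"
      using Suc.prems by (intro equipped_call) auto
    moreover have "map ((!) (x # n # loop # Suc n # xs)) [4..<4 + r] = xs"
      using map_nth_append[of "[x, n, loop, Suc n]" 4 "4 + r" xs] Suc.prems by simp
    ultimately have 2: "equipped F
        (select_index (r + 4) ([1, 0] @ [4..<4 + r]) (call_index (r + 2) (r + 4) b))
        (x # n # loop # Suc n # xs) y"
      using Suc.prems by (intro equipped_select) auto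
    have "equipped F i1 (loop # Suc n # xs) y"
      unfolding i1_def using Suc.prems
      by (intro equipped_push[OF equipped_pred equipped_push[OF 1 2]]) auto
    then have "equipped F (call_first_index (r + 2) 0) (i1 # loop # Suc n # xs) y"
      using equipped_call_first[of F i1 "loop # Suc n # xs" y "r + 2" "[]" 0] Suc by simp
    moreover have "equipped F (case_index (r + 2) 1 i0 i1) (loop # Suc n # xs) i1"
      using equipped_case[of 1 "loop # Suc n # xs" "r + 2" F i0 i1] Suc by simp
    ultimately show ?case
      using Suc by (subst loop_def) (auto intro: equipped_push)
  qed
  have "equipped F (push_index (r + 1) (const_index (r + 1) loop) loop) (n # xs) y"
    if "length xs = r" "computes (PrimRec f g) (n # xs) y" for n xs y
    using that by (intro equipped_push[OF equipped_const] loop) auto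
  then show thesis using that by blast
qed

text \<open>The search starting from \<open>i\<close> is again performed by an index that receives itself.\<close>

lemma equipped_Mu:
  assumes f: "\<And>xs y. length xs = r + 1 \<Longrightarrow> computes f xs y \<Longrightarrow> equipped F a xs y"
  obtains e where "\<And>xs y. length xs = r \<Longrightarrow> computes (Mu f) xs y \<Longrightarrow> equipped F e xs y"
proof -
  define i0 where "i0 = proj_index (r + 2) 1"
  define i1 where "i1 = push_index (r + 2) (apply_index (r + 2) succ_index 1)
    (select_index (r + 3) ([1, 1, 0] @ [3..<3 + r]) (call_first_index (r + 2) (r + 3)))"
  \<comment> \<open>The arguments \<open>loop, i, xs\<close> are extended first by the tested value and then by the selected body.\<close>
  define loop where "loop = push_index (r + 2) (drop_index 1 (r + 1) a)
    (push_index (r + 3) (case_index (r + 3) 0 i0 i1)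
      (select_index (r + 4) ([0, 2] @ [3..<4 + r]) (call_first_index (r + 2) (r + 4))))"
  have turn: "equipped F loop (loop # i # xs) z"
    if "computes f (i # xs) y" "length xs = r"
      "equipped F (if y = 0 then i0 else i1) (loop # i # xs) z" for i xs y z
  proof -
    let ?j = "if y = 0 then i0 else i1"
    have 1: "equipped F (drop_index 1 (r + 1) a) (loop # i # xs) y"
      using equipped_drop[OF f[OF _ that(1)], of "[loop]" 1] that(2) by simp
    have 2: "equipped F (case_index (r + 3) 0 i0 i1) (y # loop # i # xs) ?j"
      using equipped_case[of 0 "y # loop # i # xs" "r + 3" F i0 i1] that(2) by simp
    have "equipped F (call_first_index (r + 2) (r + 4))
        (?j # (loop # i # xs) @ (?j # y # loop # i # xs)) z"
      using that by (intro equipped_call_first) auto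
    moreover have "map ((!) (?j # y # loop # i # xs)) [3..<4 + r] = i # xs"
      using map_nth_append[of "[?j, y, loop]" 3 "4 + r" "i # xs"] that(2) by simp
    ultimately have 3: "equipped F (select_index (r + 4) ([0, 2] @ [3..<4 + r]) (call_first_index (r + 2) (r + 4)))
        (?j # y # loop # i # xs) z"
      using that(2) by (intro equipped_select) auto
    show ?thesis
      by (subst loop_def) (intro equipped_push[OF 1 equipped_push[OF 2 3]], use that(2) in auto)
  qed
  have loop: "equipped F loop (loop # i # xs) n"
    if le: "i \<le> n" and zero: "computes f (n # xs) 0"
      and pos: "\<forall>i<n. \<exists>y. computes f (i # xs) (Suc y)" and len: "length xs = r" for i n xs
    using le
  proof (induction i rule: inc_induct)
    case base
    have "equipped F i0 (loop # n # xs) n"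
      using equipped_proj[of 1 "loop # n # xs" "r + 2" F] len by (simp add: i0_def)
    then show ?case using turn[OF zero len] by simp
  next
    case (step i)
    obtain y where y: "computes f (i # xs) (Suc y)" using step.hyps pos by blast
    have 1: "equipped F (apply_index (r + 2) succ_index 1) (loop # i # xs) (Suc i)"
      using S1[of F i] len by (intro equipped_apply) auto
    have "equipped F (call_first_index (r + 2) (r + 3))
        (loop # (loop # Suc i # xs) @ (Suc i # loop # i # xs)) n"
      using step.IH len by (intro equipped_call_first) auto
    moreover have "map ((!) (Suc i # loop # i # xs)) [3..<3 + r] = xs"
      using map_nth_append[of "[Suc i, loop, i]" 3 "3 + r" xs] len by simp
    ultimately have 2: "equipped F
        (select_index (r + 3) ([1, 1, 0] @ [3..<3 + r]) (call_first_index (r + 2) (r + 3)))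
        (Suc i # loop # i # xs) n"
      using len by (intro equipped_select) auto
    have "equipped F i1 (loop # i # xs) n"
      unfolding i1_def by (rule equipped_push[OF 1 2]) (use len in auto)
    then show ?case using turn[OF y len] by simp
  qed
  have "equipped F (push_index r (const_index r 0) (push_index (r + 1) (const_index (r + 1) loop) loop)) xs y"
    if "length xs = r" "computes (Mu f) xs y" for xs y
  proof -
    have "equipped F loop (loop # 0 # xs) y"
      using that by (intro loop) (auto elim: computes_cases)
    then show ?thesis
      using that(1) by (intro equipped_push[OF equipped_const equipped_push[OF equipped_const]]) auto
  qed
  then show thesis using that by blast
qed

theorem equipped_program: "\<exists>e. \<forall>xs y. length xs = r \<longrightarrow> computes P xs y \<longrightarrow> equipped F e xs y"
proof (induction P arbitrary: r)
  case Zero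
  show ?case
    by (intro exI[of _ "const_index r 0"]) (auto elim: computes_cases intro: equipped_const)
next
  case Succ
  have "equipped F (list_encode [9, 1, 0]) [n] (n + 1)" for n
    unfolding equipped_def by (intro kleene_apply[OF S1, of _ _ "[]"]) auto
  then show ?case
    by (intro exI[of _ "list_encode [9, 1, 0]"]) (auto elim: computes_cases(2))
next
  case (Proj i)
  show ?case
    by (intro exI[of _ "proj_index r i"]) (auto elim: computes_cases(3) intro: equipped_proj)
next
  case (Comp f gs)
  obtain e where e: "\<And>ys z. length ys = length gs \<Longrightarrow> computes f ys z \<Longrightarrow> equipped F e ys z"
    using Comp.IH(1) by metis
  have "\<forall>g\<in>set gs. \<exists>e. \<forall>xs y. length xs = r \<longrightarrow> computes g xs y \<longrightarrow> equipped F e xs y"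
    using Comp.IH(2) by blast
  then obtain d where d: "\<And>g xs y. g \<in> set gs \<Longrightarrow> length xs = r \<Longrightarrow> computes g xs y \<Longrightarrow> equipped F (d g) xs y"
    by metis
  have "equipped F (args_index r (map d gs) (call_index (length gs) r e)) xs z"
    if r: "length xs = r" and z: "computes (Comp f gs) xs z" for xs z
  proof -
    obtain ys where ys: "list_all2 (\<lambda>g. computes g xs) gs ys" "computes f ys z"
      using z by (rule computes_cases(4))
    have "list_all2 (\<lambda>e. equipped F e xs) (map d gs) ys"
      using ys(1) d r unfolding list_all2_conv_all_nth by auto
    moreover have "length ys = length gs" using ys(1) by (simp add: list_all2_lengthD)
    ultimately show ?thesis
      using ys(2) r by (intro equipped_args equipped_call e) auto
  qed
  then show ?case by blast
next
  case (PrimRec f g)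
  show ?case
  proof (cases r)
    case 0
    have "\<not> computes (PrimRec f g) [] y" for y
      by (rule notI, erule computes.cases) simp_all
    then show ?thesis using 0 by auto
  next
    case (Suc k)
    obtain a b where "\<And>xs y. length xs = k \<Longrightarrow> computes f xs y \<Longrightarrow> equipped F a xs y"
      "\<And>xs y. length xs = k + 2 \<Longrightarrow> computes g xs y \<Longrightarrow> equipped F b xs y"
      using PrimRec.IH by metis
    then obtain e where "\<And>n xs y. length xs = k \<Longrightarrow> computes (PrimRec f g) (n # xs) y \<Longrightarrow> equipped F e (n # xs) y"
      using equipped_PrimRec[of k f F a g b] by blast
    then show ?thesis using Suc by (intro exI[of _ e]) (auto simp: length_Suc_conv)
  qed
next
  case (Mu f)
  obtain a where "\<And>xs y. length xs = r + 1 \<Longrightarrow> computes f xs y \<Longrightarrow> equipped F a xs y"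
    using Mu.IH by metis
  then show ?case using equipped_Mu[of r f F a] by blast
qed

lemma kleene_pca_eq_Some: "kleene_pca F e n = Some y \<longleftrightarrow> kleene F e [n] y"
  unfolding kleene_pca_def by (rule graph_val_eq_Some_iff) (rule kleene_functional)

text \<open>For arities one and two the index of the successor function is available as a constant, from S2 and
from a trivial instance of S5. This leads back from the calculus to ordinary indices.\<close>

lemma kleene_equipped:
  "equipped F e [n] y \<Longrightarrow> kleene F (list_encode [4, 1, e, list_encode [2, 1, succ_index]]) [n] y"
  unfolding equipped_def by (rule S4[OF _ S2]) auto

lemma kleene_equipped2:
  assumes "equipped F e [m, n] y"
  shows "kleene F (list_encode [4, 2, e,
    list_encode [5, 2, list_encode [2, 1, succ_index], list_encode [6, 3, 1, list_encode [3, 3]]]]) [m, n] y"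
proof -
  let ?h = "list_encode [6, 3, 1, list_encode [3, 3]]"
  have h: "kleene F ?h [i, y, n] y" for i y
    using S3[of "[y, i, n]" 3 F] by (intro kleene_move_1) auto
  have "kleene F (list_encode [5, 2, list_encode [2, 1, succ_index], ?h]) [m, n] succ_index"
  proof (induction m)
    case 0
    show ?case by (intro S5_0 S2)
  next
    case (Suc m)
    from S5_Suc[OF this h] show ?case by simp
  qed
  then show ?thesis using assms unfolding equipped_def by (intro S4) auto
qed

lemma effective_kleene_pca: "effective_pas_with_oracle (kleene_pca F) F"
proof
  obtain C where C: "\<And>m n. computes C [m, n] \<langle>m, n\<rangle>"
    using recursive2_npair unfolding recursive2_def by blast
  obtain A B where A: "\<And>n. computes A [n] (nfst n)" and B: "\<And>n. computes B [n] (nsnd n)"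
    using recursive_nfst[OF recursive_id] recursive_nsnd[OF recursive_id] unfolding recursive_def by blast
  fix P a b
  obtain e where "\<And>n y. computes P [n] y \<Longrightarrow> equipped F e [n] y"
    using equipped_program[of 1 P F] by (metis One_nat_def length_Cons list.size(3))
  then show "\<exists>e. \<forall>n y. computes P [n] y \<longrightarrow> kleene_pca F e n = Some y"
    unfolding kleene_pca_eq_Some using kleene_equipped by blast
  obtain c where c: "\<And>m n. equipped F c [m, n] \<langle>n, m\<rangle>"
    using equipped_program[of 2 "Comp C [Proj 1, Proj 0]" F] computes_Comp2[OF computes_Proj_1 computes_Proj_0 C]
    by (metis One_nat_def length_Cons list.size(3) numeral_2_eq_2)
  have "equipped F (push_index 1 (apply_index 1 b 0) (push_index 2 c (apply_index 3 a 0))) [n] z"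
    if "kleene F b [n] y" "kleene F a [\<langle>n, y\<rangle>] z" for n y z
    using that by (intro equipped_push[of F _ _ y] equipped_push[OF c] equipped_apply) auto
  then show "\<exists>c. \<forall>n y z. kleene_pca F b n = Some y \<longrightarrow> kleene_pca F a \<langle>n, y\<rangle> = Some z
      \<longrightarrow> kleene_pca F c n = Some z"
    unfolding kleene_pca_eq_Some using kleene_equipped by blast
  obtain d e where d: "\<And>i a n. equipped F d [\<langle>i, \<langle>a, n\<rangle>\<rangle>] a" and e: "\<And>i a n. equipped F e [\<langle>i, \<langle>a, n\<rangle>\<rangle>] n"
    using equipped_program[of 1 "Comp A [B]" F] equipped_program[of 1 "Comp B [B]" F]
      computes_Comp1[OF B A] computes_Comp1[OF B B]
    by (metis One_nat_def length_Cons list.size(3) nfst_npair nsnd_npair)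
  have "equipped F (args_index 1 [d, e] (apply_first_index 1)) [\<langle>i, \<langle>a, n\<rangle>\<rangle>] y"
    if "kleene F a [n] y" for i a n y
    using that d e by (intro equipped_args[where ys = "[a, n]"]) (auto intro: equipped_apply_first)
  then show "\<exists>u. \<forall>i a n y. kleene_pca F a n = Some y \<longrightarrow> kleene_pca F u \<langle>i, \<langle>a, n\<rangle>\<rangle> = Some y"
    unfolding kleene_pca_eq_Some using kleene_equipped by blast
  obtain d' e' where d': "\<And>a m n. equipped F d' [\<langle>a, m\<rangle>, n] a"
    and e': "\<And>a m n. equipped F e' [\<langle>a, m\<rangle>, n] \<langle>m, n\<rangle>"
    using equipped_program[of 2 "Comp A [Proj 0]" F]
      equipped_program[of 2 "Comp C [Comp B [Proj 0], Proj 1]" F]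
      computes_Comp1[OF computes_Proj_0 A]
      computes_Comp2[OF computes_Comp1[OF computes_Proj_0 B] computes_Proj_1 C]
    by (metis One_nat_def length_Cons list.size(3) numeral_2_eq_2 nfst_npair nsnd_npair)
  \<comment> \<open>The s-m-n function prefixes the pair \<open>\<langle>a, m\<rangle>\<close> as a constant to one fixed index \<open>q\<close> of arity two.\<close>
  define q where "q = list_encode [4, 2, args_index 2 [d', e'] (apply_first_index 2),
    list_encode [5, 2, list_encode [2, 1, succ_index], list_encode [6, 3, 1, list_encode [3, 3]]]]"
  have "kleene F q [\<langle>a, m\<rangle>, n] y" if "kleene F a [\<langle>m, n\<rangle>] y" for a m n y
    unfolding q_def using that d' e'
    by (intro kleene_equipped2 equipped_args[where ys = "[a, \<langle>m, n\<rangle>]"]) (auto intro: equipped_apply_first)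
  then have "kleene F (list_encode [4, 1, q, list_encode [2, 1, \<langle>a, m\<rangle>]]) [n] y"
    if "kleene F a [\<langle>m, n\<rangle>] y" for a m n y
    using that by (intro S4[OF _ S2]) auto
  moreover have "recursive (\<lambda>w. list_encode [4, 1, q, list_encode [2, 1, w]])"
    unfolding list_encode_ncons by (intro recursive_intros)
  ultimately show "\<exists>s. recursive s \<and> (\<forall>a m n y. kleene_pca F a \<langle>m, n\<rangle> = Some y
      \<longrightarrow> kleene_pca F (s \<langle>a, m\<rangle>) n = Some y)"
    unfolding kleene_pca_eq_Some by (intro exI[of _ "\<lambda>w. list_encode [4, 1, q, list_encode [2, 1, w]]"]) blast
  have "kleene F (list_encode [6, 2, 1, list_encode [9, 1, 0]]) [k, h] y" if "kleene F h [k] y" for h k y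
    by (intro kleene_move_1 kleene_apply[OF that, of _ "[]"]) auto
  then show "\<exists>q. \<forall>h g. (\<forall>k. kleene_pca F h k = Some (g k)) \<longrightarrow> kleene_pca F q h = Some (F g)"
    unfolding kleene_pca_eq_Some
    by (intro exI[of _ "list_encode [8, 1, list_encode [6, 2, 1, list_encode [9, 1, 0]]]"]
        allI impI S8) blast
qed

end

section \<open>The standard data in Kleene's first model\<close>

lemmas (in effective_pas) programmable_intros =
  programmable_total programmable_bind programmable_app programmable_if

lemmas (in effective_pas) programmable_K1_app = programmable_K1[OF K1.programmable_app]

lemma recursive_if_K1: "(\<And>n. K1 e n = Some (t n)) \<Longrightarrow> recursive t"
  unfolding K1_eq_Some recursive_def by (metis goedel_inject)

locale K1_data =
  fixes tt ff p :: nat and code :: "nat list \<Rightarrow> nat"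
  assumes data: "standard_data K1 tt ff p code"
begin

text \<open>The pairs \<open>p \<T> c\<close> and \<open>p \<F> v\<close>, by which a program ends a dialogue or asks a question.\<close>

definition answer :: "nat \<Rightarrow> nat"
  where "answer c = the (Some p \<cdot>\<^bsub>K1\<^esub> Some tt \<cdot>\<^bsub>K1\<^esub> Some c)"

definition query :: "nat \<Rightarrow> nat"
  where "query v = the (Some p \<cdot>\<^bsub>K1\<^esub> Some ff \<cdot>\<^bsub>K1\<^esub> Some v)"

lemma tt_neq_ff: "tt \<noteq> ff"
proof
  assume "tt = ff"
  then have "Some tt \<cdot>\<^bsub>K1\<^esub> Some 0 \<cdot>\<^bsub>K1\<^esub> Some 1 = Some (0 :: nat)"
    "Some tt \<cdot>\<^bsub>K1\<^esub> Some 0 \<cdot>\<^bsub>K1\<^esub> Some 1 = Some (1 :: nat)"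
    using data unfolding standard_data_def booleans_def by blast+
  then show False by simp
qed

lemma projections:
  obtains p0 p1 where
    "\<And>c. K1 p0 (answer c) = Some tt" "\<And>c. K1 p1 (answer c) = Some c"
    "\<And>v. K1 p0 (query v) = Some ff" "\<And>v. K1 p1 (query v) = Some v"
proof -
  obtain p0 p1 where p: "\<And>a b. Some p0 \<cdot>\<^bsub>K1\<^esub> (Some p \<cdot>\<^bsub>K1\<^esub> Some a \<cdot>\<^bsub>K1\<^esub> Some b) = Some a"
      "\<And>a b. Some p1 \<cdot>\<^bsub>K1\<^esub> (Some p \<cdot>\<^bsub>K1\<^esub> Some a \<cdot>\<^bsub>K1\<^esub> Some b) = Some b"
    using data unfolding standard_data_def pairing_def by blast
  have "\<exists>x. Some p \<cdot>\<^bsub>K1\<^esub> Some a \<cdot>\<^bsub>K1\<^esub> Some b = Some x" for a b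
    using p(1)[of a b] unfolding papp_def by (auto simp: bind_eq_Some_conv)
  then show thesis
    using that[of p0 p1] p[of tt] p[of ff] unfolding answer_def query_def
    by (metis bind.bind_lunit option.sel papp_def)
qed

lemma pair_tt: "Some p \<cdot>\<^bsub>K1\<^esub> Some tt \<cdot>\<^bsub>K1\<^esub> Some c = Some (answer c)"
  and pair_ff: "Some p \<cdot>\<^bsub>K1\<^esub> Some ff \<cdot>\<^bsub>K1\<^esub> Some c = Some (query c)"
proof -
  obtain p0 where "\<And>a b. Some p0 \<cdot>\<^bsub>K1\<^esub> (Some p \<cdot>\<^bsub>K1\<^esub> Some a \<cdot>\<^bsub>K1\<^esub> Some b) = Some a"
    using data unfolding standard_data_def pairing_def by blast
  then have "Some p \<cdot>\<^bsub>K1\<^esub> Some a \<cdot>\<^bsub>K1\<^esub> Some b \<noteq> None" for a b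
    by (metis bind_eq_None_conv option.distinct(1) papp_def)
  then show "Some p \<cdot>\<^bsub>K1\<^esub> Some tt \<cdot>\<^bsub>K1\<^esub> Some c = Some (answer c)"
    "Some p \<cdot>\<^bsub>K1\<^esub> Some ff \<cdot>\<^bsub>K1\<^esub> Some c = Some (query c)"
    unfolding answer_def query_def by auto
qed

lemma recursive_answer: "recursive t \<Longrightarrow> recursive (\<lambda>n. answer (t n))"
  and recursive_query: "recursive t \<Longrightarrow> recursive (\<lambda>n. query (t n))"
proof -
  have "Option.bind (K1 p tt) (\<lambda>e. K1 e c) = Some (answer c)"
    "Option.bind (K1 p ff) (\<lambda>e. K1 e c) = Some (query c)" for c
    using pair_tt[of c] pair_ff[of c] by (simp_all add: papp_def)
  moreover from this obtain e f where "K1 p tt = Some e" "K1 p ff = Some f"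
    by (cases "K1 p tt"; cases "K1 p ff") simp_all
  ultimately have "K1 e c = Some (answer c)" "K1 f c = Some (query c)" for c
    by simp_all
  then have "recursive answer" "recursive query" by (blast intro: recursive_if_K1)+
  then show "recursive t \<Longrightarrow> recursive (\<lambda>n. answer (t n))"
    "recursive t \<Longrightarrow> recursive (\<lambda>n. query (t n))"
    by (blast intro: recursive_comp)+
qed

definition singleton_code :: "nat \<Rightarrow> nat"
  where "singleton_code b = code [b]"

lemma recursive_singleton_code: "recursive t \<Longrightarrow> recursive (\<lambda>n. singleton_code (t n))"
proof (rule recursive_comp[of singleton_code])
  obtain e where "\<And>a. Some e \<cdot>\<^bsub>K1\<^esub> Some a = Some (code [a])"
    using data unfolding standard_data_def tuple_coding_def by blast
  then show "recursive singleton_code"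
    unfolding singleton_code_def by (intro recursive_if_K1[of e]) (simp add: papp_def)
qed

lemma concatenation:
  obtains e where "\<And>us vs. Option.bind (K1 e (code us)) (\<lambda>d. K1 d (code vs)) = Some (code (us @ vs))"
proof -
  obtain e where "\<And>us vs. Some e \<cdot>\<^bsub>K1\<^esub> Some (code us) \<cdot>\<^bsub>K1\<^esub> Some (code vs) = Some (code (us @ vs))"
    using data unfolding standard_data_def tuple_coding_def by blast
  then show thesis by (intro that[of e]) (simp add: papp_def)
qed

text \<open>The given coding of tuples and \<^const>\<open>list_encode\<close> can be translated into one another inside
\<open>K\<^sub>1\<close>, by \<open>recode\<close> and the program obtained from \<open>decoding\<close>. This uses all of the
assumptions on the coding, and reduces programming with dialogues to programming with lists.\<close>

definition recode :: "nat \<Rightarrow> nat"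
  where "recode l = code (list_decode l)"

lemma recode_list_encode [simp]: "recode (list_encode us) = code us"
  by (simp add: recode_def)

lemma recode_ncons [simp]: "recode (ncons u (list_encode us)) = code (u # us)"
  using recode_list_encode[of "u # us"] by simp

lemma recursive_recode: "recursive t \<Longrightarrow> recursive (\<lambda>n. recode (t n))"
proof (rule recursive_comp[of recode])
  obtain e where e: "\<And>us vs. Option.bind (K1 e (code us)) (\<lambda>d. K1 d (code vs)) = Some (code (us @ vs))"
    using concatenation by blast
  define \<Phi> where "\<Phi> r l = (if l = 0 then Some (code [])
      else Option.bind (K1 r (ntl l)) (\<lambda>w.
        Option.bind (K1 e (singleton_code (nhd l))) (\<lambda>d. K1 d w)))" for r l
  have "K1.programmable (\<lambda>m. \<Phi> (nfst m) (nsnd m))"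
    unfolding \<Phi>_def by (intro K1.programmable_intros recursive_intros recursive_singleton_code)
  then obtain r where r: "\<And>n y. \<Phi> r n = Some y \<Longrightarrow> K1 r n = Some y"
    using K1.recursion[of \<Phi>] by blast
  have "K1 r (list_encode us) = Some (code us)" for us
  proof (induction us)
    case Nil
    show ?case by (rule r) (simp add: \<Phi>_def)
  next
    case (Cons u us)
    then show ?case using e[of "[u]" us] by (intro r) (simp add: \<Phi>_def singleton_code_def)
  qed
  then have "K1 r l = Some (recode l)" for l
    by (metis list_decode_inverse recode_def)
  then show "recursive recode" by (rule recursive_if_K1)
qed

definition numeral_code :: "nat \<Rightarrow> nat"
  where "numeral_code i = rec_nat (answer tt) (\<lambda>_. query) i"

lemma numeral_of_eq: "numeral_of K1 tt ff p i = Some (numeral_code i)"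
  by (induction i) (simp_all add: pair_tt pair_ff numeral_code_def)

lemma recursive_numeral_code: "recursive t \<Longrightarrow> recursive (\<lambda>n. numeral_code (t n))"
  unfolding numeral_code_def by (intro recursive_rec recursive_query recursive_intros)

lemma decoding: obtains d where "\<And>us. K1 d (code us) = Some (list_encode us)"
proof -
  obtain len where "\<And>us. Some len \<cdot>\<^bsub>K1\<^esub> Some (code us) = numeral_of K1 tt ff p (length us)"
    using data unfolding standard_data_def tuple_coding_def by blast
  then have len: "K1 len (code us) = Some (numeral_code (length us))" for us
    using numeral_of_eq by (simp add: papp_def)
  obtain proj where "\<And>us i. i < length us \<Longrightarrow>
      Some proj \<cdot>\<^bsub>K1\<^esub> Some (code us) \<cdot>\<^bsub>K1\<^esub> numeral_of K1 tt ff p i = Some (us ! i)"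
    using data unfolding standard_data_def tuple_coding_def by blast
  then have proj: "Option.bind (K1 proj (code us)) (\<lambda>h. K1 h (numeral_code i)) = Some (us ! i)"
    if "i < length us" for us i
    using that numeral_of_eq by (simp add: papp_def)
  obtain p0 p1 where p: "\<And>c. K1 p0 (answer c) = Some tt" "\<And>c. K1 p1 (answer c) = Some c"
    "\<And>v. K1 p0 (query v) = Some ff" "\<And>v. K1 p1 (query v) = Some v"
    using projections by blast
  define \<Phi> where "\<Phi> r m = Option.bind (K1 p0 (nfst (nsnd m))) (\<lambda>t.
      if t = tt then Some 0
      else Option.bind (K1 p1 (nfst (nsnd m))) (\<lambda>n.
        Option.bind (K1 r \<langle>nfst m, \<langle>n, Suc (nsnd (nsnd m))\<rangle>\<rangle>) (\<lambda>l.
          Option.bind (K1 proj (nfst m)) (\<lambda>h.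
            Option.bind (K1 h (numeral_code (nsnd (nsnd m)))) (\<lambda>x. Some (ncons x l))))))" for r m
  have "K1.programmable (\<lambda>m. \<Phi> (nfst m) (nsnd m))"
    unfolding \<Phi>_def by (intro K1.programmable_intros recursive_intros recursive_numeral_code)
  then obtain r where r: "\<And>n y. \<Phi> r n = Some y \<Longrightarrow> K1 r n = Some y"
    using K1.recursion[of \<Phi>] by blast
  have loop: "K1 r \<langle>code us, \<langle>numeral_code j, i\<rangle>\<rangle> = Some (list_encode (drop i us))"
    if "i + j = length us" for us i j
    using that
  proof (induction j arbitrary: i)
    case 0
    then show ?case by (intro r) (simp add: \<Phi>_def numeral_code_def p)
  next
    case (Suc j)
    then have "K1 r \<langle>code us, \<langle>numeral_code j, Suc i\<rangle>\<rangle> = Some (list_encode (drop (Suc i) us))"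
      by simp
    moreover have "drop i us = us ! i # drop (Suc i) us"
      using Suc.prems by (simp add: Cons_nth_drop_Suc)
    moreover have "numeral_code (Suc j) = query (numeral_code j)"
      by (simp add: numeral_code_def)
    ultimately show ?case
      using proj[of i us] Suc.prems tt_neq_ff by (intro r) (auto simp: \<Phi>_def p bind_eq_Some_conv)
  qed
  have "K1.programmable (\<lambda>w. Option.bind (K1 len w) (\<lambda>n. K1 r \<langle>w, \<langle>n, 0\<rangle>\<rangle>))"
    by (intro K1.programmable_intros recursive_intros)
  then obtain d where "\<And>w y. Option.bind (K1 len w) (\<lambda>n. K1 r \<langle>w, \<langle>n, 0\<rangle>\<rangle>) = Some y \<Longrightarrow> K1 d w = Some y"
    unfolding K1.programmable_def by blast
  then show thesis using len loop[of 0] by (intro that[of d]) simp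
qed

text \<open>For the rest of the development this is all that needs to be known about the coding: dialogue
programs can be specified on lists.\<close>

lemma code_program:
  assumes "K1.programmable \<psi>"
  obtains e where "\<And>us y. \<psi> (list_encode us) = Some y \<Longrightarrow> K1 e (code us) = Some y"
proof -
  obtain d where d: "\<And>us. K1 d (code us) = Some (list_encode us)"
    using decoding by blast
  have "K1.programmable (\<lambda>m. \<psi> (nsnd m))"
    by (rule K1.programmable_comp[OF assms]) (intro recursive_intros)
  then have "K1.programmable (\<lambda>w. Option.bind (K1 d w) \<psi>)"
    by (intro K1.programmable_bind K1.programmable_app recursive_intros)
  then obtain e where "\<And>w y. Option.bind (K1 d w) \<psi> = Some y \<Longrightarrow> K1 e w = Some y"
    unfolding K1.programmable_def by blast
  then show thesis using d by (intro that[of e]) simp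
qed

section \<open>Dialogues\<close>

text \<open>A dialogue seen from the current position, with \<open>ws\<close> consisting of the argument and the replies so
far. Simulations of dialogues thereby become rule inductions.\<close>

inductive run :: "(nat \<rightharpoonup> nat) \<Rightarrow> nat \<Rightarrow> nat list \<Rightarrow> nat \<Rightarrow> bool"
  for f a where
  answer: "K1 a (code ws) = Some (answer c) \<Longrightarrow> run f a ws c"
| query: "K1 a (code ws) = Some (query v) \<Longrightarrow> f v = Some y \<Longrightarrow> run f a (ws @ [y]) c \<Longrightarrow> run f a ws c"

lemma dialogue_iff: "dialogue K1 ff p code f a b us \<longleftrightarrow>
    (\<forall>i<length us. \<exists>v. K1 a (code (b # take i us)) = Some (query v) \<and> f v = Some (us ! i))"
  unfolding dialogue_def pair_ff by auto

lemma rel_app_graph_iff: "rel_app_graph K1 tt ff p code f a b c \<longleftrightarrow>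
    (\<exists>us. dialogue K1 ff p code f a b us \<and> K1 a (code (b # us)) = Some (answer c))"
  unfolding rel_app_graph_def pair_tt by auto

lemma rel_app_graph_iff_run: "rel_app_graph K1 tt ff p code f a b c \<longleftrightarrow> run f a [b] c"
proof
  assume "rel_app_graph K1 tt ff p code f a b c"
  then obtain us where us: "dialogue K1 ff p code f a b us" "K1 a (code (b # us)) = Some (answer c)"
    unfolding rel_app_graph_iff by blast
  have "run f a (b # take i us) c" if "i \<le> length us" for i
    using that
  proof (induction i rule: inc_induct)
    case base
    show ?case using us(2) by (simp add: run.answer)
  next
    case (step i)
    then obtain v where "K1 a (code (b # take i us)) = Some (query v)" "f v = Some (us ! i)"
      using us(1) unfolding dialogue_iff by blast
    moreover have "run f a ((b # take i us) @ [us ! i]) c"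
      using step by (simp add: take_Suc_conv_app_nth)
    ultimately show ?case by (rule run.query)
  qed
  from this[of 0] show "run f a [b] c" by simp
next
  assume "run f a [b] c"
  moreover have "\<exists>us. (\<forall>i<length us. \<exists>v. K1 a (code (ws @ take i us)) = Some (query v) \<and> f v = Some (us ! i))
      \<and> K1 a (code (ws @ us)) = Some (answer c)" if "run f a ws c" for ws
    using that
  proof induction
    case (answer ws c)
    then show ?case by (intro exI[of _ "[]"]) simp
  next
    case (query ws v y c)
    from query.IH obtain us where us:
      "\<forall>i<length us. \<exists>v. K1 a (code ((ws @ [y]) @ take i us)) = Some (query v) \<and> f v = Some (us ! i)"
      "K1 a (code ((ws @ [y]) @ us)) = Some (answer c)" by (elim exE conjE)
    have "\<exists>v. K1 a (code (ws @ take i (y # us))) = Some (query v) \<and> f v = Some ((y # us) ! i)"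
      if "i < length (y # us)" for i
      using that us(1) query.hyps(1,2) by (cases i) auto
    then show ?case using us(2) by (intro exI[of _ "y # us"]) auto
  qed
  ultimately show "rel_app_graph K1 tt ff p code f a b c"
    unfolding rel_app_graph_iff dialogue_iff by fastforce
qed

abbreviation app :: "(nat \<rightharpoonup> nat) \<Rightarrow> nat pas"
  where "app \<equiv> rel_pca K1 tt ff p code"

lemma app_iff_run: "app f a b = Some c \<longleftrightarrow> run f a [b] c"
  unfolding rel_pca_def
  by (subst graph_val_eq_Some_iff[OF rel_app_graph_functional[OF data]]) (simp_all add: rel_app_graph_iff_run)

lemma run_mono: "run f a ws c \<Longrightarrow> f \<subseteq>\<^sub>m g \<Longrightarrow> run g a ws c"
proof (induction rule: run.induct)
  case (query ws v y c)
  then have "g v = Some y" unfolding map_le_def by (metis domI)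
  with query show ?case by (blast intro: run.query)
qed (rule run.answer)

lemma app_mono: "app f a b = Some c \<Longrightarrow> f \<subseteq>\<^sub>m g \<Longrightarrow> app g a b = Some c"
  unfolding app_iff_run by (rule run_mono)

text \<open>A program \<open>c\<close> at position \<open>ws\<close> may hand over the rest of the dialogue to the program \<open>a\<close>, which is
to believe that its dialogue has started with the argument \<open>n\<close> at this moment.\<close>

lemma run_transfer:
  assumes "\<And>us y. K1 a (code (n # us)) = Some y \<Longrightarrow> K1 c (code (ws @ us)) = Some y"
    and "run f a [n] z"
  shows "run f c ws z"
proof -
  have "run f c (ws @ us) z" if "run f a vs z" "vs = n # us" for vs us
    using that
  proof (induction arbitrary: us)
    case (answer vs z)
    then show ?case using assms(1) by (intro run.answer) simp
  next
    case (query vs v y z)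
    then have "run f c ((ws @ us) @ [y]) z" by simp
    moreover have "K1 c (code (ws @ us)) = Some (local.query v)"
      using query assms(1) by simp
    ultimately show ?case using query.hyps(2) run.query by blast
  qed
  from this[OF assms(2), of "[]"] show ?thesis by simp
qed

text \<open>The composite conducts the dialogue of \<open>b\<close> until \<open>b\<close> answers, and from then on that of \<open>a\<close>. As the
program only sees the list of all replies, it replays \<open>b\<close> on longer and longer
initial segments in order to find out which replies were addressed to \<open>b\<close>.\<close>

lemma app_sequence: "\<exists>c. \<forall>n y z. run f b [n] y \<longrightarrow> run f a [\<langle>n, y\<rangle>] z \<longrightarrow> run f c [n] z"
proof -
  obtain cc where cc: "\<And>us vs. Option.bind (K1 cc (code us)) (\<lambda>d. K1 d (code vs)) = Some (code (us @ vs))"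
    using concatenation by blast
  obtain p0 p1 where p: "\<And>c. K1 p0 (answer c) = Some tt" "\<And>c. K1 p1 (answer c) = Some c"
    "\<And>v. K1 p0 (query v) = Some ff" "\<And>v. K1 p1 (query v) = Some v"
    using projections by blast
  define \<Phi> where "\<Phi> r m = Option.bind (K1 b (nfst (nsnd m))) (\<lambda>x. Option.bind (K1 p0 x) (\<lambda>t.
      if t = tt then Option.bind (K1 p1 x) (\<lambda>y. K1 a (recode (ncons \<langle>nfst m, y\<rangle> (nsnd (nsnd m)))))
      else if nsnd (nsnd m) = 0 then Some x
      else Option.bind (K1 cc (nfst (nsnd m))) (\<lambda>d.
        Option.bind (K1 d (singleton_code (nhd (nsnd (nsnd m))))) (\<lambda>w.
          K1 r \<langle>nfst m, \<langle>w, ntl (nsnd (nsnd m))\<rangle>\<rangle>))))" for r m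
  have "K1.programmable (\<lambda>m. \<Phi> (nfst m) (nsnd m))"
    unfolding \<Phi>_def
    by (intro K1.programmable_intros recursive_intros recursive_recode recursive_singleton_code)
  then obtain r where r: "\<And>n y. \<Phi> r n = Some y \<Longrightarrow> K1 r n = Some y"
    using K1.recursion[of \<Phi>] by blast
  have "K1.programmable (\<lambda>l. K1 r \<langle>nhd l, \<langle>singleton_code (nhd l), ntl l\<rangle>\<rangle>)"
    by (intro K1.programmable_intros recursive_intros recursive_singleton_code)
  then obtain c where "\<And>us x. K1 r \<langle>nhd (list_encode us), \<langle>singleton_code (nhd (list_encode us)), ntl (list_encode us)\<rangle>\<rangle> = Some x
      \<Longrightarrow> K1 c (code us) = Some x"
    by (rule code_program) blast
  from this[of "_ # _"] have c: "K1 r \<langle>n, \<langle>code [n], list_encode us\<rangle>\<rangle> = Some x \<Longrightarrow> K1 c (code (n # us)) = Some x" for n us x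
    by (simp add: singleton_code_def)
  \<comment> \<open>The third premise says that the replay has reached the position \<open>ws\<close> without an answer of \<open>b\<close>.\<close>
  have main: "run f c ws z"
    if "run f b ws y" "run f a [\<langle>n, y\<rangle>] z"
      "\<And>us x. K1 r \<langle>n, \<langle>code ws, list_encode us\<rangle>\<rangle> = Some x \<Longrightarrow> K1 c (code (ws @ us)) = Some x" for ws n y z
    using that
  proof (induction rule: run.induct)
    case (answer ws y)
    show ?case
    proof (rule run_transfer[OF _ answer.prems(1)])
      fix us x
      assume "K1 a (code (\<langle>n, y\<rangle> # us)) = Some x"
      then have "\<Phi> r \<langle>n, \<langle>code ws, list_encode us\<rangle>\<rangle> = Some x"
        using answer.hyps by (simp add: \<Phi>_def p)
      then show "K1 c (code (ws @ us)) = Some x" by (intro answer.prems(2) r)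
    qed
  next
    case (query ws v u y)
    have "\<Phi> r \<langle>n, \<langle>code ws, list_encode []\<rangle>\<rangle> = Some (query v)"
      using query.hyps(1) tt_neq_ff by (simp add: \<Phi>_def p)
    then have 1: "K1 c (code ws) = Some (query v)"
      using query.prems(2)[of "[]"] r by simp
    have "K1 c (code ((ws @ [u]) @ us)) = Some x"
      if x: "K1 r \<langle>n, \<langle>code (ws @ [u]), list_encode us\<rangle>\<rangle> = Some x" for us x
    proof -
      obtain d where "K1 cc (code ws) = Some d" "K1 d (code [u]) = Some (code (ws @ [u]))"
        using cc[of ws "[u]"] by (auto simp: bind_eq_Some_conv)
      then have "\<Phi> r \<langle>n, \<langle>code ws, list_encode (u # us)\<rangle>\<rangle> = Some x"
        using query.hyps(1) tt_neq_ff x by (simp add: \<Phi>_def p singleton_code_def)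
      then show ?thesis using query.prems(2)[of "u # us"] r by simp
    qed
    then have "run f c (ws @ [u]) z" by (intro query.IH query.prems(1)) blast
    then show ?case by (rule run.query[of c ws v f u, OF 1 query.hyps(2)])
  qed
  have "run f c [n] z" if "run f b [n] y" "run f a [\<langle>n, y\<rangle>] z" for n y z
    using main[OF that] c by simp
  then show ?thesis by blast
qed

lemma effective_app: "effective_pas (app f)"
proof
  fix P a b
  have "K1.programmable (\<lambda>l. Option.bind (K1 (goedel P) (nhd l)) (\<lambda>y. Some (answer y)))"
    by (intro K1.programmable_intros recursive_intros recursive_answer)
  then obtain e where
    "\<And>us y. Option.bind (K1 (goedel P) (nhd (list_encode us))) (\<lambda>y. Some (answer y)) = Some y
      \<Longrightarrow> K1 e (code us) = Some y"
    by (rule code_program) blast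
  from this[of "[_]"] show "\<exists>e. \<forall>n y. computes P [n] y \<longrightarrow> app f e n = Some y"
    unfolding app_iff_run by (intro exI[of _ e]) (auto simp: K1_goedel[THEN iffD2] intro: run.answer)
  show "\<exists>c. \<forall>n y z. app f b n = Some y \<longrightarrow> app f a \<langle>n, y\<rangle> = Some z \<longrightarrow> app f c n = Some z"
    unfolding app_iff_run by (rule app_sequence)
  have "K1.programmable (\<lambda>l. K1 (nfst (nsnd (nhd l))) (recode (ncons (nsnd (nsnd (nhd l))) (ntl l))))"
    by (intro K1.programmable_intros recursive_intros recursive_recode)
  then obtain u where
    "\<And>us y. K1 (nfst (nsnd (nhd (list_encode us)))) (recode (ncons (nsnd (nsnd (nhd (list_encode us)))) (ntl (list_encode us)))) = Some y
      \<Longrightarrow> K1 u (code us) = Some y"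
    by (rule code_program) blast
  from this[of "_ # _"] have u: "K1 a (code (n # us)) = Some y \<Longrightarrow> K1 u (code ([\<langle>i, \<langle>a, n\<rangle>\<rangle>] @ us)) = Some y" for i a n us y
    by simp
  show "\<exists>u. \<forall>i a n y. app f a n = Some y \<longrightarrow> app f u \<langle>i, \<langle>a, n\<rangle>\<rangle> = Some y"
    unfolding app_iff_run using run_transfer[OF u] by blast
  obtain d where d: "\<And>us. K1 d (code us) = Some (list_encode us)"
    using decoding by blast
  have "K1.programmable (\<lambda>m. Option.bind (K1 d (nsnd m)) (\<lambda>l.
      K1 (nfst (nfst m)) (recode (ncons \<langle>nsnd (nfst m), nhd l\<rangle> (ntl l)))))"
    by (intro K1.programmable_intros recursive_intros recursive_recode)
  then obtain e where "\<And>m y. Option.bind (K1 d (nsnd m)) (\<lambda>l.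
      K1 (nfst (nfst m)) (recode (ncons \<langle>nsnd (nfst m), nhd l\<rangle> (ntl l)))) = Some y \<Longrightarrow> K1 e m = Some y"
    unfolding K1.programmable_def by blast
  from this[of "\<langle>\<langle>_, _\<rangle>, code (_ # _)\<rangle>"] have "K1 a (code (\<langle>m, n\<rangle> # us)) = Some y
      \<Longrightarrow> K1 e \<langle>\<langle>a, m\<rangle>, code (n # us)\<rangle> = Some y" for a m n us y
    by (simp add: d)
  then have "K1 a (code (\<langle>m, n\<rangle> # us)) = Some y
      \<Longrightarrow> K1 (K1.curry_index e \<langle>a, m\<rangle>) (code ([n] @ us)) = Some y" for a m n us y
    by (simp add: K1.app_curry_index)
  from run_transfer[OF this] show "\<exists>s. recursive s \<and>
      (\<forall>a m n y. app f a \<langle>m, n\<rangle> = Some y \<longrightarrow> app f (s \<langle>a, m\<rangle>) n = Some y)"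
    unfolding app_iff_run
    by (intro exI[of _ "K1.curry_index e"] conjI)
      (use K1.recursive_curry_index[OF recursive_const recursive_id] in auto)
qed

text \<open>The program that passes its argument on as a question and returns the reply.\<close>

lemma query_program: obtains q where "\<And>f v y. f v = Some y \<Longrightarrow> app f q v = Some y"
proof -
  have "K1.programmable (\<lambda>l. Some (if ntl l = 0 then query (nhd l) else answer (nhd (ntl l))))"
    by (intro K1.programmable_intros recursive_intros recursive_query recursive_answer)
  then obtain q where "\<And>us y. Some (if ntl (list_encode us) = 0 then query (nhd (list_encode us)) else answer (nhd (ntl (list_encode us)))) = Some y
      \<Longrightarrow> K1 q (code us) = Some y"
    by (rule code_program) blast
  from this[of "[_]"] this[of "[_, _]"]
  have "K1 q (code [v]) = Some (query v)" "K1 q (code [v, y]) = Some (answer y)" for v y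
    by simp_all
  then have "run f q [v] y" if "f v = Some y" for f v y
    using run.query[of q "[v]" v f y, OF _ that] run.answer[of q "[v, y]"] by simp
  then show thesis by (intro that) (simp add: app_iff_run)
qed

end

section \<open>The stages of the functional\<close>

lemma map_le_iff: "f \<subseteq>\<^sub>m g \<longleftrightarrow> (\<forall>a b. f a = Some b \<longrightarrow> g a = Some b)"
  unfolding map_le_def dom_def by auto

lemma union_map_SomeD: "union_map M a = Some b \<Longrightarrow> \<exists>m\<in>M. m a = Some b"
proof -
  assume "union_map M a = Some b"
  then have "\<exists>!b. \<exists>m\<in>M. m a = Some b" "b = (THE b. \<exists>m\<in>M. m a = Some b)"
    unfolding union_map_def graph_val_def by (auto split: if_splits)
  then show ?thesis using theI'[of "\<lambda>b. \<exists>m\<in>M. m a = Some b"] by simp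
qed

lemma union_map_SomeI:
  assumes "\<And>m m'. m \<in> M \<Longrightarrow> m' \<in> M \<Longrightarrow> m \<subseteq>\<^sub>m m' \<or> m' \<subseteq>\<^sub>m m"
    and "m \<in> M" "m a = Some b"
  shows "union_map M a = Some b"
  unfolding union_map_def
proof (subst graph_val_eq_Some_iff)
  fix y z
  assume "\<exists>m\<in>M. m a = Some y" "\<exists>m\<in>M. m a = Some z"
  then obtain m m' where "m \<in> M" "m a = Some y" "m' \<in> M" "m' a = Some z" by blast
  then show "y = z" using assms(1)[of m m'] unfolding map_le_iff by (metis option.inject)
qed (use assms(2,3) in blast)

lemma ordinals_induct [case_names less]:
  assumes "\<And>\<alpha>. (\<And>\<beta>. \<beta> \<in> underS ordinals \<alpha> \<Longrightarrow> P \<beta>) \<Longrightarrow> P \<alpha>"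
  shows "P \<alpha>"
  by (rule wo_rel.well_order_induct[OF wo_rel_ordinals]) (use assms in \<open>auto simp: underS_def\<close>)

lemma underS_total:
  assumes "wo_rel r" "\<beta> \<in> underS r \<alpha>" "\<gamma> \<in> underS r \<alpha>"
  shows "\<beta> \<in> underS r \<gamma> \<or> \<beta> = \<gamma> \<or> \<gamma> \<in> underS r \<beta>"
  using assms wo_rel.TOTALS[OF assms(1)] unfolding underS_def by (blast intro: FieldI1)

text \<open>There is no last stage, because an infinite cardinal is a limit ordinal.\<close>

lemma successor_exists:
  assumes "\<alpha> \<in> Field (ordinals :: nat set rel)"
  shows "\<exists>\<beta>\<in>Field ordinals. is_successor ordinals \<alpha> \<beta>"
proof -
  let ?r = "ordinals :: nat set rel"
  define B where "B = {\<beta>. \<beta> \<noteq> \<alpha> \<and> (\<alpha>, \<beta>) \<in> ?r}"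
  have "infinite (Field ?r)"
    by (simp add: cardSuc_finite[OF card_of_Card_order] Field_card_of)
  then have "B \<noteq> {}"
    using infinite_Card_order_limit[OF cardSuc_Card_order[OF card_of_Card_order] _ assms]
    unfolding B_def by blast
  moreover have "wf (?r - Id)" by (rule wo_rel.WF[OF wo_rel_ordinals])
  ultimately obtain \<beta> where b: "\<beta> \<in> B" "\<And>\<gamma>. (\<gamma>, \<beta>) \<in> ?r - Id \<Longrightarrow> \<gamma> \<notin> B"
    by (metis ex_in_conv wfE_min)
  have "(\<gamma>, \<alpha>) \<in> ?r" if "\<gamma> \<in> underS ?r \<beta>" for \<gamma>
    using that b(2)[of \<gamma>] assms wo_rel.TOTALS[OF wo_rel_ordinals] unfolding B_def underS_def
    by (blast intro: FieldI1)
  then have "is_successor ?r \<alpha> \<beta>"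
    using b(1) unfolding is_successor_def B_def underS_def by blast
  moreover have "\<beta> \<in> Field ?r" using b(1) unfolding B_def by (blast intro: FieldI2)
  ultimately show ?thesis by blast
qed

locale K1_functional = K1_data tt ff p code for tt ff p code +
  fixes F :: "(nat \<Rightarrow> nat) \<Rightarrow> nat"
begin

abbreviation "next_map \<equiv> next_stage K1 tt ff p code (\<lambda>g. Some (F g))"
abbreviation "stage_map \<equiv> stage K1 tt ff p code (\<lambda>g. Some (F g))"
abbreviation "limit_map \<equiv> functional_map K1 tt ff p code (\<lambda>g. Some (F g))"

lemma next_map_iff:
  "next_map f a = Some b \<longleftrightarrow> (\<exists>g. (\<forall>x. app f a x = Some (g x)) \<and> F g = b)"
proof -
  have "g = h" if "\<forall>x. app f a x = Some (g x)" "\<forall>x. app f a x = Some (h x)" for g h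
    using that by (intro ext) simp
  then show ?thesis
    unfolding next_stage_def option.inject by (intro graph_val_eq_Some_iff) blast
qed

lemma next_map_mono: "f \<subseteq>\<^sub>m g \<Longrightarrow> next_map f \<subseteq>\<^sub>m next_map g"
  unfolding map_le_iff[of "next_map f"] next_map_iff by (metis app_mono)

text \<open>Induction over the stages. Only successor stages produce values; limits collect
those of earlier stages.\<close>

lemma limit_map_induct:
  assumes "\<And>f. \<forall>v y. f v = Some y \<longrightarrow> P v y \<Longrightarrow> \<forall>v y. next_map f v = Some y \<longrightarrow> P v y"
    and "limit_map v = Some y"
  shows "P v y"
proof -
  have "\<forall>v y. stage_map \<alpha> v = Some y \<longrightarrow> P v y" for \<alpha>
  proof (induction \<alpha> rule: ordinals_induct)
    case (less \<alpha>)
    consider "underS ordinals \<alpha> = {}" | \<beta> where "is_successor ordinals \<beta> \<alpha>"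
      | "underS ordinals \<alpha> \<noteq> {}" "\<nexists>\<beta>. is_successor ordinals \<beta> \<alpha>" by blast
    then show ?case
    proof cases
      case 1
      then show ?thesis by (simp add: stage_zero)
    next
      case 2
      then have "\<beta> \<in> underS ordinals \<alpha>" unfolding is_successor_def by blast
      from assms(1)[OF less[OF this]] show ?thesis by (simp add: stage_successor[OF 2])
    next
      case 3
      then show ?thesis using less by (auto simp: stage_limit dest!: union_map_SomeD)
    qed
  qed
  then show ?thesis using assms(2) unfolding functional_map_def by (auto dest!: union_map_SomeD)
qed

text \<open>That the stages increase and that each of them is contained in the next one has to be proved
simultaneously: the first statement at successors needs the second one, and the second
statement at successors and limits follows from the first by monotonicity.\<close>

lemma stage_map_increasing:
  "(\<forall>\<beta>\<in>underS ordinals \<alpha>. stage_map \<beta> \<subseteq>\<^sub>m stage_map \<alpha>) \<and> stage_map \<alpha> \<subseteq>\<^sub>m next_map (stage_map \<alpha>)"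
proof (induction \<alpha> rule: ordinals_induct)
  case (less \<alpha>)
  consider "underS ordinals \<alpha> = {}" | \<beta> where "is_successor ordinals \<beta> \<alpha>"
    | "underS ordinals \<alpha> \<noteq> {}" "\<nexists>\<beta>. is_successor ordinals \<beta> \<alpha>" by blast
  then show ?case
  proof cases
    case 1
    then show ?thesis by (simp add: stage_zero)
  next
    case 2
    then have b: "\<beta> \<in> underS ordinals \<alpha>" and max: "\<And>\<gamma>. \<gamma> \<in> underS ordinals \<alpha> \<Longrightarrow> (\<gamma>, \<beta>) \<in> ordinals"
      unfolding is_successor_def by blast+
    have eq: "stage_map \<alpha> = next_map (stage_map \<beta>)" by (rule stage_successor[OF 2])
    have le: "stage_map \<beta> \<subseteq>\<^sub>m stage_map \<alpha>" using less[OF b] eq by simp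
    have "stage_map \<gamma> \<subseteq>\<^sub>m stage_map \<alpha>" if "\<gamma> \<in> underS ordinals \<alpha>" for \<gamma>
    proof (cases "\<gamma> = \<beta>")
      case False
      then have "\<gamma> \<in> underS ordinals \<beta>" using max[OF that] unfolding underS_def by blast
      then show ?thesis using less[OF b] le map_le_trans by blast
    qed (simp add: le)
    then show ?thesis using next_map_mono[OF le] eq by simp
  next
    case 3
    have chain: "m \<subseteq>\<^sub>m m' \<or> m' \<subseteq>\<^sub>m m"
      if m: "m \<in> stage_map ` underS ordinals \<alpha>" "m' \<in> stage_map ` underS ordinals \<alpha>" for m m'
    proof -
      obtain \<beta> \<gamma> where "\<beta> \<in> underS ordinals \<alpha>" "\<gamma> \<in> underS ordinals \<alpha>" "m = stage_map \<beta>" "m' = stage_map \<gamma>"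
        using m by blast
      then show ?thesis using underS_total[OF wo_rel_ordinals, of \<beta> \<alpha> \<gamma>] less[of \<beta>] less[of \<gamma>] by auto
    qed
    have le: "stage_map \<beta> \<subseteq>\<^sub>m stage_map \<alpha>" if "\<beta> \<in> underS ordinals \<alpha>" for \<beta>
      unfolding stage_limit[OF 3] map_le_iff
      by (intro allI impI union_map_SomeI[OF _ imageI[OF that]] chain)
    have "next_map (stage_map \<alpha>) v = Some y" if y: "stage_map \<alpha> v = Some y" for v y
    proof -
      obtain \<beta> where b: "\<beta> \<in> underS ordinals \<alpha>" "stage_map \<beta> v = Some y"
        using union_map_SomeD[OF y[unfolded stage_limit[OF 3]]] by blast
      then have "next_map (stage_map \<beta>) v = Some y"
        using less unfolding map_le_iff by blast
      then show ?thesis using next_map_mono[OF le[OF b(1)]] unfolding map_le_iff by blast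
    qed
    then show ?thesis using le unfolding map_le_iff by blast
  qed
qed

lemma stage_map_mono: "(\<beta>, \<alpha>) \<in> ordinals \<Longrightarrow> stage_map \<beta> \<subseteq>\<^sub>m stage_map \<alpha>"
  using stage_map_increasing[of \<alpha>] unfolding underS_def by (cases "\<beta> = \<alpha>") auto

lemma stage_map_le_limit_map:
  assumes "\<alpha> \<in> Field ordinals"
  shows "stage_map \<alpha> \<subseteq>\<^sub>m limit_map"
proof -
  have "m \<subseteq>\<^sub>m m' \<or> m' \<subseteq>\<^sub>m m" if "m \<in> stage_map ` Field ordinals" "m' \<in> stage_map ` Field ordinals" for m m'
    using that wo_rel.TOTALS[OF wo_rel_ordinals] stage_map_mono by blast
  from union_map_SomeI[OF this imageI[OF assms]] show ?thesis
    unfolding functional_map_def map_le_iff by blast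
qed

text \<open>The graph of the functional map is countable and covered by an increasing chain indexed by
\<open>\<aleph>\<^sub>1\<close>, a regular cardinal, so a single member of the chain covers it.\<close>

lemma limit_map_is_stage:
  obtains \<alpha> where "\<alpha> \<in> Field ordinals" "limit_map \<subseteq>\<^sub>m stage_map \<alpha>"
proof -
  define graph :: "(nat \<rightharpoonup> nat) \<Rightarrow> (nat \<times> nat) set" where "graph f = {(v, y). f v = Some y}" for f
  have le: "graph f \<subseteq> graph g \<longleftrightarrow> f \<subseteq>\<^sub>m g" for f g
    unfolding graph_def map_le_iff by auto
  have "relChain ordinals (\<lambda>\<alpha>. graph (stage_map \<alpha>))"
    unfolding relChain_def le using stage_map_mono by blast
  moreover have "graph limit_map \<subseteq> (\<Union>\<alpha>\<in>Field ordinals. graph (stage_map \<alpha>))"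
    unfolding graph_def functional_map_def using union_map_SomeD by fastforce
  moreover have "(card_of (graph limit_map), card_of (UNIV :: nat set)) \<in> ordLeq"
    by (metis card_of_ordLeq inj_on_subset inj_prod_encode subset_UNIV)
  ultimately obtain \<alpha> where "\<alpha> \<in> Field ordinals" "graph limit_map \<subseteq> graph (stage_map \<alpha>)"
    using cardSuc_UNION[OF card_of_Card_order, of "UNIV :: nat set" "\<lambda>\<alpha>. graph (stage_map \<alpha>)" "graph limit_map"]
    by (auto simp: Field_card_of)
  then show thesis using that le by blast
qed

text \<open>Since the functional map is a stage, applying the step to it produces another stage.\<close>

lemma next_limit_map: "next_map limit_map \<subseteq>\<^sub>m limit_map"
proof -
  obtain \<alpha> where a: "\<alpha> \<in> Field ordinals" "limit_map \<subseteq>\<^sub>m stage_map \<alpha>"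
    by (rule limit_map_is_stage)
  obtain \<beta> where b: "\<beta> \<in> Field ordinals" "is_successor ordinals \<alpha> \<beta>"
    using successor_exists[OF a(1)] by blast
  have "next_map limit_map \<subseteq>\<^sub>m next_map (stage_map \<alpha>)" by (rule next_map_mono[OF a(2)])
  also have "next_map (stage_map \<alpha>) = stage_map \<beta>" by (simp add: stage_successor[OF b(2)])
  finally show ?thesis using stage_map_le_limit_map[OF b(1)] map_le_trans by blast
qed

lemma functional_pca_eq: "functional_pca K1 tt ff p code (\<lambda>g. Some (F g)) = app limit_map"
  unfolding functional_pca_def ..

lemma effective_functional_pca: "effective_pas_with_oracle (functional_pca K1 tt ff p code (\<lambda>g. Some (F g))) F"
proof -
  interpret effective_pas "app limit_map" by (rule effective_app)
  show ?thesis
    unfolding functional_pca_eq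
  proof
    obtain q where q: "\<And>f v y. f v = Some y \<Longrightarrow> app f q v = Some y" by (rule query_program) blast
    have "limit_map h = Some (F g)" if "\<forall>k. app limit_map h k = Some (g k)" for h g
    proof -
      have "next_map limit_map h = Some (F g)" using that by (auto simp: next_map_iff)
      then show ?thesis using next_limit_map unfolding map_le_iff by blast
    qed
    then show "\<exists>q. \<forall>h g. (\<forall>k. app limit_map h k = Some (g k)) \<longrightarrow> app limit_map q h = Some (F g)"
      using q by blast
  qed
qed

end

section \<open>Interpreting the two structures\<close>

text \<open>The interpreter \<open>r\<close> receives a program together with the code of a position in its dialogue. A query
\<open>v\<close> is answered by the oracle of \<open>X\<close>, applied to an index of the function that runs
\<open>v\<close> on the position consisting of the argument only. The predicate \<open>P v y\<close> states that
the oracle, asked in this way about \<open>v\<close>, returns \<open>y\<close>; that it holds for all values of the functional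
map is shown stage by stage.\<close>

lemma (in K1_functional) programmable_functional_pca:
  assumes "effective_pas_with_oracle X F"
  shows "effective_pas.programmable X
    (\<lambda>m. functional_pca K1 tt ff p code (\<lambda>g. Some (F g)) (nfst m) (nsnd m))"
proof -
  interpret X: effective_pas_with_oracle X F by (rule assms)
  obtain cc where cc: "\<And>us vs. Option.bind (K1 cc (code us)) (\<lambda>d. K1 d (code vs)) = Some (code (us @ vs))"
    using concatenation by blast
  obtain p0 p1 where p: "\<And>c. K1 p0 (answer c) = Some tt" "\<And>c. K1 p1 (answer c) = Some c"
    "\<And>v. K1 p0 (query v) = Some ff" "\<And>v. K1 p1 (query v) = Some v"
    using projections by blast
  obtain q where q: "\<And>h g. (\<forall>k. X h k = Some (g k)) \<Longrightarrow> X q h = Some (F g)"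
    using X.functional by blast
  have "X.programmable (\<lambda>m. X (nfst (nfst m)) \<langle>nsnd (nfst m), singleton_code (nsnd m)\<rangle>)"
    by (intro X.programmable_intros recursive_intros recursive_singleton_code)
  then obtain e where e: "\<And>r v k y. X r \<langle>v, singleton_code k\<rangle> = Some y \<Longrightarrow> X e \<langle>\<langle>r, v\<rangle>, k\<rangle> = Some y"
    unfolding X.programmable_def by (metis nfst_npair nsnd_npair)
  define \<Phi> where "\<Phi> r m = Option.bind (K1 (nfst m) (nsnd m)) (\<lambda>x.
      Option.bind (K1 p0 x) (\<lambda>t. Option.bind (K1 p1 x) (\<lambda>v.
        if t = tt then Some v
        else Option.bind (X q (X.curry_index e \<langle>r, v\<rangle>)) (\<lambda>y.
          Option.bind (K1 cc (nsnd m)) (\<lambda>d. Option.bind (K1 d (singleton_code y)) (\<lambda>w.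
            X r \<langle>nfst m, w\<rangle>))))))" for r m
  have "X.programmable (\<lambda>m. \<Phi> (nfst m) (nsnd m))"
    unfolding \<Phi>_def
    by (intro X.programmable_intros X.programmable_K1_app recursive_intros recursive_singleton_code
        X.recursive_curry_index)
  then obtain r where r: "\<And>n y. \<Phi> r n = Some y \<Longrightarrow> X r n = Some y"
    using X.recursion[of \<Phi>] by blast
  define P where "P v y \<longleftrightarrow> (\<exists>g. (\<forall>k. X r \<langle>v, code [k]\<rangle> = Some (g k)) \<and> F g = y)" for v y
  have run: "X r \<langle>a, code ws\<rangle> = Some c" if "run f a ws c" "\<And>v y. f v = Some y \<Longrightarrow> P v y" for f a ws c
    using that
  proof (induction rule: run.induct)
    case (answer ws c)
    then show ?case by (intro r) (simp add: \<Phi>_def p)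
  next
    case (query ws v y c)
    then obtain g where g: "\<And>k. X r \<langle>v, code [k]\<rangle> = Some (g k)" "F g = y"
      unfolding P_def by blast
    then have "X q (X.curry_index e \<langle>r, v\<rangle>) = Some y"
      using q[of "X.curry_index e \<langle>r, v\<rangle>" g] by (simp add: X.app_curry_index e singleton_code_def)
    moreover obtain d where "K1 cc (code ws) = Some d" "K1 d (code [y]) = Some (code (ws @ [y]))"
      using cc[of ws "[y]"] by (auto simp: bind_eq_Some_conv)
    ultimately show ?case
      using query tt_neq_ff by (intro r) (simp add: \<Phi>_def p singleton_code_def)
  qed
  have "P v y" if "limit_map v = Some y" for v y
    using _ that
  proof (rule limit_map_induct)
    fix f
    assume f: "\<forall>v y. f v = Some y \<longrightarrow> P v y"
    have "P v (F g)" if "\<forall>x. run f v [x] (g x)" for v g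
      using that run[of f] f unfolding P_def[of v] by blast
    then show "\<forall>v y. next_map f v = Some y \<longrightarrow> P v y"
      unfolding next_map_iff app_iff_run by blast
  qed
  then have "X r \<langle>a, singleton_code b\<rangle> = Some c"
    if "functional_pca K1 tt ff p code (\<lambda>g. Some (F g)) a b = Some c" for a b c
    using that run unfolding functional_pca_eq app_iff_run singleton_code_def by blast
  moreover have "X.programmable (\<lambda>m. X r \<langle>nfst m, singleton_code (nsnd m)\<rangle>)"
    by (intro X.programmable_intros recursive_intros recursive_singleton_code)
  ultimately show ?thesis unfolding X.programmable_def by meson
qed

text \<open>Moves the first \<open>k\<close> entries of \<open>a\<close> one by one to the front of \<open>b\<close>. Doing this twice
yields initial segments of coded lists and thus the rearrangements of S6 and S9.\<close>

definition rev_onto :: "nat \<Rightarrow> nat \<Rightarrow> nat \<Rightarrow> nat"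
  where "rev_onto k a b = nfst (((\<lambda>m. \<langle>ncons (nhd (nsnd m)) (nfst m), ntl (nsnd m)\<rangle>) ^^ k) \<langle>b, a\<rangle>)"

lemma rev_onto_list_encode:
  "k \<le> length xs \<Longrightarrow> rev_onto k (list_encode xs) (list_encode ys) = list_encode (rev (take k xs) @ ys)"
proof (induction k arbitrary: xs ys)
  case (Suc k)
  then obtain x xs' where "xs = x # xs'" by (cases xs) auto
  then show ?case
    using Suc.IH[of xs' "x # ys"] Suc.prems
    by (simp add: rev_onto_def funpow_Suc_right del: funpow.simps(2))
qed (simp add: rev_onto_def)

lemma recursive_rev_onto:
  "recursive s \<Longrightarrow> recursive t \<Longrightarrow> recursive u \<Longrightarrow> recursive (\<lambda>n. rev_onto (s n) (t n) (u n))"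
  unfolding rev_onto_def
  by (intro recursive_nfst recursive_funpow recursive_npair recursive_ncons recursive_nhd
      recursive_ntl recursive_nsnd recursive_id)

definition take_code :: "nat \<Rightarrow> nat \<Rightarrow> nat"
  where "take_code k l = rev_onto k (rev_onto k l 0) 0"

definition front_code :: "nat \<Rightarrow> nat \<Rightarrow> nat"
  where "front_code k l = ncons (nnth l k) (rev_onto k (rev_onto k l 0) ((ntl ^^ Suc k) l))"

lemma recursive_take_code: "recursive s \<Longrightarrow> recursive t \<Longrightarrow> recursive (\<lambda>n. take_code (s n) (t n))"
  unfolding take_code_def by (intro recursive_rev_onto recursive_const)

lemma recursive_front_code: "recursive s \<Longrightarrow> recursive t \<Longrightarrow> recursive (\<lambda>n. front_code (s n) (t n))"
  unfolding front_code_def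
  by (intro recursive_rev_onto recursive_const recursive_ncons recursive_nnth recursive_funpow
      recursive_Suc recursive_ntl recursive_nfst recursive_id)

lemma take_code_list_encode:
  assumes "k \<le> length xs"
  shows "take_code k (list_encode xs) = list_encode (take k xs)"
  using assms rev_onto_list_encode[of k xs "[]"] rev_onto_list_encode[of k "rev (take k xs)" "[]"]
  by (simp add: take_code_def)

lemma funpow_ntl: "k \<le> length xs \<Longrightarrow> (ntl ^^ k) (list_encode xs) = list_encode (drop k xs)"
proof (induction k arbitrary: xs)
  case (Suc k)
  then show ?case by (cases xs) (simp_all add: funpow_Suc_right del: funpow.simps(2))
qed simp

lemma front_code_list_encode:
  assumes "k < length xs"
  shows "front_code k (list_encode xs) = list_encode (xs ! k # take k xs @ drop (k + 1) xs)"
  using assms rev_onto_list_encode[of k xs "[]"] funpow_ntl[of "Suc k" xs]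
    rev_onto_list_encode[of k "rev (take k xs)" "drop (k + 1) xs"]
  by (simp add: front_code_def nnth_list_encode del: funpow.simps)

text \<open>The interpreter need not check the arities recorded in an index, as it only has to be correct on
arguments on which the index is defined.\<close>

lemma programmable_kleene_pca:
  assumes "effective_pas_with_oracle X F"
  shows "effective_pas.programmable X (\<lambda>m. kleene_pca F (nfst m) (nsnd m))"
proof -
  interpret X: effective_pas_with_oracle X F by (rule assms)
  obtain q where q: "\<And>h g. (\<forall>k. X h k = Some (g k)) \<Longrightarrow> X q h = Some (F g)"
    using X.functional by blast
  have "X.programmable (\<lambda>m. X (nfst (nfst m))
      \<langle>nfst (nsnd (nfst m)), ncons (nsnd m) (ncons (nsnd (nsnd (nfst m))) 0)\<rangle>)"
    by (intro X.programmable_intros recursive_intros)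
  then obtain e where e: "\<And>r h n k y. X r \<langle>h, ncons k (ncons n 0)\<rangle> = Some y
      \<Longrightarrow> X e \<langle>\<langle>r, \<langle>h, n\<rangle>\<rangle>, k\<rangle> = Some y"
    unfolding X.programmable_def by (metis nfst_npair nsnd_npair)
  define \<Phi>5 where "\<Phi>5 r i a b l =
    (if nhd l = 0 then X r \<langle>a, ntl l\<rangle>
     else Option.bind (X r \<langle>i, ncons (nhd l - 1) (ntl l)\<rangle>) (\<lambda>y.
       X r \<langle>b, ncons (nhd l - 1) (ncons y (ntl l))\<rangle>))" for r i a b l
  \<comment> \<open>The tag of the index \<open>i\<close> is \<open>t\<close>, and \<open>a\<close> and \<open>b\<close> are its third and fourth entries.\<close>
  define \<Psi> where "\<Psi> r i t a b l =
    (if t = 1 then Some (Suc (nhd l))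
     else if t = 2 then Some a
     else if t = 3 then Some (nhd l)
     else if t = 4 then Option.bind (X r \<langle>b, l\<rangle>) (\<lambda>y. X r \<langle>a, ncons y l\<rangle>)
     else if t = 5 then \<Phi>5 r i a b l
     else if t = 6 then X r \<langle>b, front_code a l\<rangle>
     else if t = 8 then X q (X.curry_index e \<langle>r, \<langle>a, nhd l\<rangle>\<rangle>)
     else X r \<langle>nhd l, take_code (nhd (ntl i)) (ntl l)\<rangle>)" for r i t a b l :: nat
  define \<Phi> where "\<Phi> r m = \<Psi> r (nfst m) (nhd (nfst m)) (nhd (ntl (ntl (nfst m))))
    (nhd (ntl (ntl (ntl (nfst m))))) (nsnd m)" for r m
  have "X.programmable (\<lambda>m. \<Phi> (nfst m) (nsnd m))"
    unfolding \<Phi>_def \<Psi>_def \<Phi>5_def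
    by (intro X.programmable_intros recursive_intros X.recursive_curry_index recursive_front_code
        recursive_take_code)
  then obtain r where r: "\<And>n y. \<Phi> r n = Some y \<Longrightarrow> X r n = Some y"
    using X.recursion[of \<Phi>] by blast
  have "X r \<langle>i, list_encode ns\<rangle> = Some y" if "kleene F i ns y" for i ns y
    using that
  proof (induction rule: kleene.induct)
    case (S3 ns m)
    then show ?case by (cases ns; intro r; simp add: \<Phi>_def \<Psi>_def)
  next
    case (S6 ns s k g z)
    then show ?case
      using front_code_list_encode[of k ns] by (intro r) (simp add: \<Phi>_def \<Psi>_def)
  next
    case (S8 h n g)
    have "X (X.curry_index e \<langle>r, \<langle>h, n\<rangle>\<rangle>) k = Some (g k)" for k
      using S8.IH[rule_format, of k] by (intro X.app_curry_index e) simp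
    then show ?case
      using q[of "X.curry_index e \<langle>r, \<langle>h, n\<rangle>\<rangle>" g] by (intro r) (simp add: \<Phi>_def \<Psi>_def)
  next
    case (S9 ns k l m z)
    then show ?case by (intro r) (simp add: \<Phi>_def \<Psi>_def take_code_list_encode)
  qed (intro r; simp add: \<Phi>_def \<Psi>_def \<Phi>5_def)+
  then have "X r \<langle>a, ncons b 0\<rangle> = Some c" if "kleene_pca F a b = Some c" for a b c
    using that unfolding kleene_pca_eq_Some by fastforce
  moreover have "X.programmable (\<lambda>m. X r \<langle>nfst m, ncons (nsnd m) 0\<rangle>)"
    by (intro X.programmable_intros recursive_intros)
  ultimately show ?thesis unfolding X.programmable_def by meson
qed

theorem theorem4p3:
  fixes F :: "(nat \<Rightarrow> nat) \<Rightarrow> nat"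
    and tt ff p :: nat
    and code :: "nat list \<Rightarrow> nat"
  assumes "standard_data K1 tt ff p code"
  shows "pca_isomorphic (functional_pca K1 tt ff p code (\<lambda>g. Some (F g))) (kleene_pca F)"
proof -
  interpret K1_functional tt ff p code F
    by unfold_locales (rule assms)
  interpret A: effective_pas_with_oracle "functional_pca K1 tt ff p code (\<lambda>g. Some (F g))" F
    by (rule effective_functional_pca)
  interpret B: effective_pas_with_oracle "kleene_pca F" F
    by (rule effective_kleene_pca)
  have "applicative_morphism (functional_pca K1 tt ff p code (\<lambda>g. Some (F g))) (kleene_pca F) Id"
    by (intro B.applicative_morphism_Id programmable_functional_pca effective_kleene_pca)
  moreover have "applicative_morphism (kleene_pca F) (functional_pca K1 tt ff p code (\<lambda>g. Some (F g))) Id"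
    by (intro A.applicative_morphism_Id programmable_kleene_pca effective_functional_pca)
  ultimately show ?thesis
    unfolding pca_isomorphic_def using A.pca B.pca by (metis R_O_Id)
qed

end
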